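(* Let $H_0:\mathbb T^N\times[0,T]\times\mathbb R^N\to\mathbb R$ be continuous, convex in $p$, superlinear in $p$ uniformly for $(x,t)\in\mathbb T^N\times[0,T]$, and differentiable in $p$ on $\mathbb R^N$, with derivative $H^0_p$. Let $g_0:\mathbb T^N\to\mathbb R$ be continuous and let $v$ be the Lax–Oleinik solution with final datum $g_0$. Then there exists a set $B\subset\mathbb T^N\times[0,T]$ which contains a subset of $\mu_\zeta$-full measure for every $g_0$-optimal curve $\zeta$, such that $$\mathcal A_{g_0}\supset B\qquad\text{and}\qquad W_{g_0}(x,t)=H^0_p(x,t,-Dv(x,t))$$ for all $(x,t)\in B$ where $v$ is differentiable in space (i.e. $v(\cdot,t)$ is differentiable at $x$, with gradient $Dv(x,t)$).
   Context: $\mathbb T^N$ is the $N$-dimensional flat torus, $T>0$, $\Gamma=C([0,T];\mathbb T^N)$. Uniform superlinearity means $H_0(x,t,p)/|p|\to+\infty$ as $|p|\to+\infty$ uniformly in $(x,t)$. $L_0(x,t,q)=\sup_p(p\cdot q-H_0(x,t,p))$; $A_{L_0}(\zeta)=\int_0^TL_0(\zeta,t,\dot\zeta)\,dt$ for absolutely continuous $\zeta\in\Gamma$ and $+\infty$ otherwise. The Lax–Oleinik solution with final datum $g_0$ is $v(x,t)=\min\{g_0(\zeta(T))+\int_t^TL_0(\zeta,s,\dot\zeta)\,ds:\ \zeta:[t,T]\to\mathbb T^N\text{ absolutely continuous},\ \zeta(t)=x\}$ for $t<T$, $v(x,T)=g_0(x)$. A curve $\zeta_0\in\Gamma$ is $g_0$-optimal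 if it minimizes $g_0(\zeta(T))+A_{L_0}(\zeta)$ among $\zeta\in\Gamma$ with $\zeta(0)=\zeta_0(0)$. For $\zeta\in\Gamma$, the space–time occupation measure $\mu_\zeta$ on $\mathbb T^N\times[0,T]$ is $\mu_\zeta(B)=\frac1T\,\big|\{t\in[0,T]:(\zeta(t),t)\in B\}\big|$ (Lebesgue measure) for Borel $B$; it is a probability measure, so full measure means measure $1$. For $(x,t)\in\mathbb T^N\times(0,T)$, $D_{(q,1)}v(x,t)=\lim_{h\to0}\frac{v(x+hq,t+h)-v(x,t)}h$ when it exists; $\mathcal W_{g_0}(x,t)=\{q\in\mathbb R^N:D_{(q,1)}v(x,t)\text{ exists and equals }-L_0(x,t,q)\}$; $\mathcal A_{g_0}=\{(x,t)\in\mathbb T^N\times(0,T):\mathcal W_{g_0}(x,t)\neq\emptyset\}$. Under the stated assumptions $\mathcal W_{g_0}(x,t)$ has at most one element, denoted $W_{g_0}(x,t)$ when $(x,t)\in\mathcal A_{g_0}$. *)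

theory Defs
  imports "HOL-Analysis.Analysis"
begin

section \<open>The flat torus\<close>

quotient_type (overloaded) 'n torus = "real ^ ('n::finite)" /
    "\<lambda>x y. \<forall>i. x $ i - y $ i \<in> \<int>"
proof (rule equivpI)
  show "reflp (\<lambda>x y :: real ^ 'n. \<forall>i. x $ i - y $ i \<in> \<int>)"
    by (simp add: reflp_def)
  show "symp (\<lambda>x y :: real ^ 'n. \<forall>i. x $ i - y $ i \<in> \<int>)"
    by (auto intro!: sympI) (metis Ints_minus minus_diff_eq)
  show "transp (\<lambda>x y :: real ^ 'n. \<forall>i. x $ i - y $ i \<in> \<int>)"
  proof (rule transpI, rule allI)
    fix x y z :: "real ^ 'n" and i
    assume "\<forall>i. x $ i - y $ i \<in> \<int>" "\<forall>i. y $ i - z $ i \<in> \<int>"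
    then have "(x $ i - y $ i) + (y $ i - z $ i) \<in> \<int>"
      by (intro Ints_add) auto
    then show "x $ i - z $ i \<in> \<int>" by simp
  qed
qed

lift_definition torus_of :: "real ^ 'n \<Rightarrow> ('n::finite) torus" is "\<lambda>x. x" .

lift_definition torus_shift :: "('n::finite) torus \<Rightarrow> real ^ 'n \<Rightarrow> 'n torus" is "(+)"
  by simp

lemma torus_of_eq_iff: "torus_of x = torus_of y \<longleftrightarrow> (\<forall>i. x $ i - y $ i \<in> \<int>)"
  by transfer simp

text \<open>The quotient topology. The product topology on products with the torus and the Borel
  \<open>\<sigma>\<close>-algebra \<open>borel\<close> are then the library's.\<close>

instantiation torus :: (finite) topological_space
begin

definition open_torus :: "'a torus set \<Rightarrow> bool"
  where "open_torus U \<longleftrightarrow> open (torus_of -` U)"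

instance
  by standard (auto simp: open_torus_def vimage_Union vimage_Int intro: open_Int)

end

section \<open>Absolutely continuous curves and their velocity\<close>

definition abs_cont_on :: "real \<Rightarrow> real \<Rightarrow> (real \<Rightarrow> 'a::real_normed_vector) \<Rightarrow> bool"
  where "abs_cont_on a b \<xi> \<longleftrightarrow>
    (\<forall>\<epsilon>>0. \<exists>\<delta>>0. \<forall>d S. d division_of S \<and> S \<subseteq> {a..b} \<and> (\<Sum>k\<in>d. Sup k - Inf k) < \<delta> \<longrightarrow>
      (\<Sum>k\<in>d. norm (\<xi> (Sup k) - \<xi> (Inf k))) < \<epsilon>)"

text \<open>Curves are total functions on \<open>real\<close>; only their values on the relevant interval matter.
  A curve in the torus is absolutely continuous if it has an absolutely continuous lift.\<close>

definition torus_abs_cont_on :: "real \<Rightarrow> real \<Rightarrow> (real \<Rightarrow> ('n::finite) torus) \<Rightarrow> bool"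
  where "torus_abs_cont_on a b \<zeta> \<longleftrightarrow>
    (\<exists>\<xi>. abs_cont_on a b \<xi> \<and> (\<forall>s\<in>{a..b}. \<zeta> s = torus_of (\<xi> s)))"

text \<open>The lift \<open>\<xi>\<close> below need only be well behaved at \<open>t\<close>. Two lifts that are continuous at \<open>t\<close>
  differ by a constant near \<open>t\<close>, so the velocity does not depend on the lift.\<close>

definition has_torus_velocity :: "(real \<Rightarrow> ('n::finite) torus) \<Rightarrow> real ^ 'n \<Rightarrow> real \<Rightarrow> bool"
  where "has_torus_velocity \<zeta> q t \<longleftrightarrow>
    (\<exists>\<xi>. (\<forall>s. \<zeta> s = torus_of (\<xi> s)) \<and> (\<xi> has_vector_derivative q) (at t))"

definition torus_velocity :: "(real \<Rightarrow> ('n::finite) torus) \<Rightarrow> real \<Rightarrow> real ^ 'n"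
  where "torus_velocity \<zeta> t = (THE q. has_torus_velocity \<zeta> q t)"

lemma has_torus_velocity_unique:
  assumes "has_torus_velocity \<zeta> q t" "has_torus_velocity \<zeta> r t"
  shows "q = r"
proof -
  obtain \<xi> where \<xi>: "\<And>s. \<zeta> s = torus_of (\<xi> s)" "(\<xi> has_vector_derivative q) (at t)"
    using assms(1) by (auto simp: has_torus_velocity_def)
  obtain \<eta> where \<eta>: "\<And>s. \<zeta> s = torus_of (\<eta> s)" "(\<eta> has_vector_derivative r) (at t)"
    using assms(2) by (auto simp: has_torus_velocity_def)
  have D: "((\<lambda>s. \<xi> s - \<eta> s) has_vector_derivative q - r) (at t)"
    by (intro derivative_intros \<xi> \<eta>)
  have Ints: "(\<xi> s - \<eta> s) $ i \<in> \<int>" for s i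
    using torus_of_eq_iff[of "\<xi> s" "\<eta> s"] \<xi>(1)[of s] \<eta>(1)[of s] by auto
  have "continuous (at t) (\<lambda>s. \<xi> s - \<eta> s)"
    using D by (rule has_vector_derivative_continuous)
  then have "((\<lambda>s. \<xi> s - \<eta> s) \<longlongrightarrow> \<xi> t - \<eta> t) (at t)"
    by (simp add: continuous_at)
  then have "\<forall>\<^sub>F s in at t. dist (\<xi> s - \<eta> s) (\<xi> t - \<eta> t) < 1"
    by (rule tendstoD) simp
  then have ev: "\<forall>\<^sub>F s in at t. \<xi> s - \<eta> s = \<xi> t - \<eta> t"
  proof eventually_elim
    case (elim s)
    show ?case
    proof (rule vec_eq_iff[THEN iffD2], rule allI)
      fix i
      have "\<bar>((\<xi> s - \<eta> s) - (\<xi> t - \<eta> t)) $ i\<bar> < 1"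
        using component_le_norm_cart elim by (metis dist_norm le_less_trans)
      then have "\<bar>(\<xi> s - \<eta> s) $ i - (\<xi> t - \<eta> t) $ i\<bar> < 1"
        by simp
      then show "(\<xi> s - \<eta> s) $ i = (\<xi> t - \<eta> t) $ i"
        using Ints_nonzero_abs_less1[OF Ints_diff[OF Ints Ints]] by auto
    qed
  qed
  have "((\<lambda>s. \<xi> s - \<eta> s) has_vector_derivative 0) (at t)"
    unfolding has_vector_derivative_def
    by (rule has_derivative_transform_eventually[where f = "\<lambda>_. \<xi> t - \<eta> t"])
      (use ev in \<open>auto elim!: eventually_mono intro!: derivative_eq_intros\<close>)
  then have "q - r = 0"
    using D vector_derivative_unique_at by blast
  then show ?thesis by simp
qed

lemma torus_velocity_eqI: "has_torus_velocity \<zeta> q t \<Longrightarrow> torus_velocity \<zeta> t = q"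
  unfolding torus_velocity_def using has_torus_velocity_unique by blast

section \<open>Lagrangian, action, Lax--Oleinik solution, optimal curves\<close>

type_synonym 'n phase_fun = "'n torus \<Rightarrow> real \<Rightarrow> real ^ 'n \<Rightarrow> real"

definition superlinear_on :: "real \<Rightarrow> ('n::finite) phase_fun \<Rightarrow> bool"
  where "superlinear_on T H \<longleftrightarrow>
    (\<forall>K. \<forall>\<^sub>F p in at_infinity. \<forall>x. \<forall>t\<in>{0..T}. K \<le> H x t p / norm p)"

definition lagrangian :: "('n::finite) phase_fun \<Rightarrow> 'n phase_fun"
  where "lagrangian H x t q = (SUP p. inner p q - H x t p)"

text \<open>The Lagrangians of interest are bounded below along curves, so that the integral of a
  measurable integrand either converges absolutely or is \<open>+\<infinity>\<close>.\<close>

definition action :: "('n::finite) phase_fun \<Rightarrow> real \<Rightarrow> real \<Rightarrow> (real \<Rightarrow> 'n torus) \<Rightarrow> ereal"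
  where "action L a b \<zeta> =
    (if torus_abs_cont_on a b \<zeta> \<and>
        (\<lambda>s. L (\<zeta> s) s (torus_velocity \<zeta> s)) absolutely_integrable_on {a..b}
     then ereal (integral {a..b} (\<lambda>s. L (\<zeta> s) s (torus_velocity \<zeta> s)))
     else \<infinity>)"

text \<open>The infimum is taken in \<open>ereal\<close>; for the Hamiltonians considered it is finite and
  attained.\<close>

definition lax_oleinik ::
    "('n::finite) phase_fun \<Rightarrow> ('n torus \<Rightarrow> real) \<Rightarrow> real \<Rightarrow> 'n torus \<Rightarrow> real \<Rightarrow> real"
  where "lax_oleinik H g T x t =
    (if t < T
     then real_of_ereal
       (INF \<zeta>\<in>{\<zeta>. torus_abs_cont_on t T \<zeta> \<and> \<zeta> t = x}.
         ereal (g (\<zeta> T)) + action (lagrangian H) t T \<zeta>)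
     else g x)"

definition optimal_curve ::
    "('n::finite) phase_fun \<Rightarrow> ('n torus \<Rightarrow> real) \<Rightarrow> real \<Rightarrow> (real \<Rightarrow> 'n torus) \<Rightarrow> bool"
  where "optimal_curve H g T \<zeta> \<longleftrightarrow> continuous_on {0..T} \<zeta> \<and>
    (\<forall>\<eta>. continuous_on {0..T} \<eta> \<and> \<eta> 0 = \<zeta> 0 \<longrightarrow>
      ereal (g (\<zeta> T)) + action (lagrangian H) 0 T \<zeta>
        \<le> ereal (g (\<eta> T)) + action (lagrangian H) 0 T \<eta>)"

text \<open>To be used for Borel \<open>B\<close> and \<open>\<zeta>\<close> continuous on \<open>{0..T}\<close>.\<close>

definition occupation :: "real \<Rightarrow> (real \<Rightarrow> ('n::finite) torus) \<Rightarrow> ('n torus \<times> real) set \<Rightarrow> real"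
  where "occupation T \<zeta> B = measure lborel {t\<in>{0..T}. (\<zeta> t, t) \<in> B} / T"

section \<open>Generalized velocities\<close>

definition has_spacetime_deriv ::
    "(('n::finite) torus \<Rightarrow> real \<Rightarrow> real) \<Rightarrow> 'n torus \<Rightarrow> real \<Rightarrow> real ^ 'n \<Rightarrow> real \<Rightarrow> bool"
  where "has_spacetime_deriv v x t q D \<longleftrightarrow>
    ((\<lambda>h. (v (torus_shift x (h *\<^sub>R q)) (t + h) - v x t) / h) \<longlongrightarrow> D) (at 0)"

definition W_set ::
    "('n::finite) phase_fun \<Rightarrow> ('n torus \<Rightarrow> real) \<Rightarrow> real \<Rightarrow> 'n torus \<Rightarrow> real \<Rightarrow> (real ^ 'n) set"
  where "W_set H g T x t =
    {q. has_spacetime_deriv (lax_oleinik H g T) x t q (- lagrangian H x t q)}"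

definition A_set ::
    "('n::finite) phase_fun \<Rightarrow> ('n torus \<Rightarrow> real) \<Rightarrow> real \<Rightarrow> ('n torus \<times> real) set"
  where "A_set H g T = {(x, t). t \<in> {0<..<T} \<and> W_set H g T x t \<noteq> {}}"

definition W_elem ::
    "('n::finite) phase_fun \<Rightarrow> ('n torus \<Rightarrow> real) \<Rightarrow> real \<Rightarrow> 'n torus \<Rightarrow> real \<Rightarrow> real ^ 'n"
  where "W_elem H g T x t = (THE q. q \<in> W_set H g T x t)"

text \<open>Differentiability in space, read in the chart of the torus centred at the point.\<close>

definition has_space_gradient ::
    "(('n::finite) torus \<Rightarrow> real) \<Rightarrow> real ^ 'n \<Rightarrow> 'n torus \<Rightarrow> bool"
  where "has_space_gradient u p x \<longleftrightarrow> GDERIV (\<lambda>y. u (torus_shift x y)) 0 :> p"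

end

theory Submission
  imports Defs
begin

text \<open>
  Along a \<open>g\<^sub>0\<close>-optimal curve \<open>\<zeta>\<close> dynamic programming gives
  \<open>v (\<zeta> t, t) = g\<^sub>0 (\<zeta> T) + \<integral> L\<^sub>0\<close> over \<open>[t, T]\<close>, so at almost every \<open>t\<close> the curve has a
  velocity \<open>q\<close> and \<open>v (\<zeta> t, t)\<close> has derivative \<open>- L\<^sub>0 (\<zeta> t, t, q)\<close>. The value function need not be
  Lipschitz, but comparing \<open>v (x + h q, t + h)\<close> with the values along \<open>\<zeta>\<close> through short straight
  segments of velocity close to \<open>q\<close> turns this into \<open>D\<^sub>(\<^sub>q\<^sub>,\<^sub>1\<^sub>) v = - L\<^sub>0\<close>. Hence \<open>\<A>\<close> itself
  serves as \<open>B\<close>. If \<open>v (_, t)\<close> has gradient \<open>p\<close> at \<open>x\<close> and \<open>q \<in> \<W> (x, t)\<close>, then the straight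
  segment from \<open>(x - h q, t - h)\<close> with velocity \<open>w\<close> gives
  \<open>L\<^sub>0 (q) \<le> L\<^sub>0 (w) + p \<bullet> (w - q)\<close> for all \<open>w\<close>, i.e. \<open>- p\<close> is a subgradient of \<open>L\<^sub>0\<close> at \<open>q\<close>, and
  Legendre duality yields \<open>q = H\<^sub>p (- p)\<close>; in particular \<open>q\<close> is unique.
\<close>

section \<open>Absolutely continuous curves are differentiable almost everywhere\<close>

text \<open>The obstacle is that v is accessible only through its infimum formula. Every estimate of
  v off the curve is therefore an instance of one inequality, dynamic programming along a segment of
  finite action, which is itself obtained from near-minimisers. Both bounds on the space-time
  derivative come from it: the point (x + hq, t + h) serves once as the end and once as the start of
  a short segment. Superlinearity enters because it makes the Lagrangian finite and continuous.
  Absolute continuity is the epsilon-delta notion over finite divisions. Velocities are extracted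
  from it by a Vitali argument on the slopes of intervals straddling a point, applied to the
  coordinates of a lift. \<open>W_elem\<close> is a definite description, so the formula for it
  includes uniqueness wherever v is differentiable in space. Full measure is witnessed by a Borel
  piece of the graph of the curve, which bypasses the measurability of \<open>A_set\<close>.\<close>

lemma sum_increments_division:
  fixes f :: "real \<Rightarrow> real"
  assumes "d division_of {a..b}" "a \<le> b"
  shows "(\<Sum>k\<in>d. f (Sup k) - f (Inf k)) = f b - f a"
proof -
  let ?f = "\<lambda>K::real set. if K = {} then 0 else f (Sup K) - f (Inf K)"
  \<comment> \<open>The increment is additive when an interval is cut in two, so the division
    theorem for operative functions telescopes the sum. The value 0 on the empty set is part of
    being operative.\<close>
  interpret operative_real plus 0 ?f
    rewrites "comm_monoid_set.F (+) 0 = sum"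
    by standard[1] (auto simp add: sum_def)
  from division[OF assms(1)] have "sum ?f d = ?f {a..b}" by simp
  moreover have "sum ?f d = (\<Sum>k\<in>d. f (Sup k) - f (Inf k))"
    using assms(1) by (intro sum.cong) (auto simp: division_of_def)
  ultimately show ?thesis using assms(2) by simp
qed

text \<open>Compact intervals are the closed balls of the line, so Vitali's theorem for balls gives
  countably many disjoint admissible intervals covering almost all of E. Finitely many of them
  already cover E up to \<epsilon>. The open set U is there to control where the intervals lie and
  hence their total length.\<close>

lemma Vitali_covering_intervals:
  fixes E U :: "real set"
  assumes E: "E \<in> lmeasurable" and U: "open U" "E \<subseteq> U" and "\<epsilon> > 0"
    and fine: "\<And>x \<delta>. x \<in> E \<Longrightarrow> \<delta> > 0 \<Longrightarrow> \<exists>y z. y < x \<and> x < z \<and> z - y < \<delta> \<and> P y z"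
  obtains D where "finite D" "D division_of \<Union>D" "pairwise disjnt D"
    "\<And>k. k \<in> D \<Longrightarrow> \<exists>y z. k = {y..z} \<and> y < z \<and> P y z"
    "\<Union>D \<subseteq> U" "measure lebesgue (E - \<Union>D) < \<epsilon>"
proof -
  define K where "K = {(y, z). y < z \<and> P y z \<and> {y..z} \<subseteq> U}"
  define c r where "c i = (fst i + snd i) / 2" and "r i = (snd i - fst i) / 2" for i :: "real \<times> real"
  have cb: "cball (c i) (r i) = {fst i..snd i}" for i
    by (auto simp: cball_eq_atLeastAtMost c_def r_def field_simps)
  obtain C where C: "countable C" "C \<subseteq> K"
    "pairwise (\<lambda>i j. disjnt (cball (c i) (r i)) (cball (c j) (r j))) C"
    "negligible (E - (\<Union>i\<in>C. cball (c i) (r i)))"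
  proof (rule Vitali_covering_theorem_cballs[of K r E c])
    show "0 < r i" if "i \<in> K" for i using that by (auto simp: K_def r_def)
    fix x \<delta> :: real assume x: "x \<in> E" and \<delta>: "\<delta> > 0"
    obtain e where e: "e > 0" "ball x e \<subseteq> U" using U x open_contains_ball by blast
    obtain y z where yz: "y < x" "x < z" "z - y < min \<delta> e" "P y z"
      using fine[OF x, of "min \<delta> e"] \<delta> e by auto
    have "{y..z} \<subseteq> ball x e" using yz by (auto simp: dist_real_def)
    then have "(y, z) \<in> K" using yz e by (auto simp: K_def)
    moreover have "x \<in> cball (c (y, z)) (r (y, z))" using yz unfolding cb by auto
    moreover have "r (y, z) < \<delta>" using yz \<delta> by (auto simp: r_def)
    ultimately show "\<exists>i. i \<in> K \<and> x \<in> cball (c i) (r i) \<and> r i < \<delta>" by blast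
  qed
  define I where "I i = {fst i..snd i}" for i :: "real \<times> real"
  note C' = C[unfolded cb, folded I_def]
  have Em: "E \<in> sets lebesgue" using E by (simp add: fmeasurableD)
  have meas: "E \<inter> I i \<in> lmeasurable" for i
    using E by (intro fmeasurable_Int_fmeasurable) (auto simp: I_def)
  \<comment> \<open>The traces on E, not the intervals themselves, are exhausted: the measures of
    their finite unions are bounded by that of E.\<close>
  obtain D' where D': "D' \<subseteq> (\<lambda>i. E \<inter> I i) ` C" "finite D'"
    "measure lebesgue (\<Union>((\<lambda>i. E \<inter> I i) ` C)) - \<epsilon> < measure lebesgue (\<Union>D')"
  proof (rule measure_countable_Union_approachable[of "(\<lambda>i. E \<inter> I i) ` C" \<epsilon> "measure lebesgue E"])
    show "measure lebesgue (\<Union>D') \<le> measure lebesgue E"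
      if "D' \<subseteq> (\<lambda>i. E \<inter> I i) ` C" "finite D'" for D'
    proof (rule measure_mono_fmeasurable)
      show "\<Union>D' \<in> sets lebesgue"
        using that meas by (intro sets.finite_Union) (auto intro: fmeasurableD)
    qed (use that E in auto)
  qed (use C' meas \<open>\<epsilon> > 0\<close> in auto)
  obtain C0 where C0: "C0 \<subseteq> C" "finite C0" "D' = (\<lambda>i. E \<inter> I i) ` C0"
    using finite_subset_image[OF D'(2,1)] by auto
  have mU: "measure lebesgue (\<Union>((\<lambda>i. E \<inter> I i) ` C)) = measure lebesgue E"
  proof -
    have eq: "E = \<Union>((\<lambda>i. E \<inter> I i) ` C) \<union> (E - \<Union>(I ` C))" by auto
    have "(\<lambda>i. E \<inter> I i) ` C \<subseteq> sets lebesgue" using meas by (auto intro: fmeasurableD)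
    then have s: "\<Union>((\<lambda>i. E \<inter> I i) ` C) \<in> sets lebesgue"
      using C'(1) by (intro sets.countable_Union) auto
    have "E - \<Union>(I ` C) \<in> null_sets lebesgue" using C'(4) by (simp add: negligible_iff_null_sets)
    from measure_Un_null_set[OF s this] show ?thesis using eq by simp
  qed
  define D where "D = I ` C0"
  have finD: "finite D" using C0 by (simp add: D_def)
  have dis: "pairwise disjnt D"
  proof (rule pairwiseI)
    fix k l assume "k \<in> D" "l \<in> D" "k \<noteq> l"
    then obtain i j where "i \<in> C" "j \<in> C" "k = I i" "l = I j" "i \<noteq> j"
      unfolding D_def image_iff using C0(1) by (metis subsetD)
    then show "disjnt k l" using C'(3) by (simp add: pairwise_def)
  qed
  have kD: "\<exists>y z. k = {y..z} \<and> y < z \<and> P y z \<and> {y..z} \<subseteq> U" if "k \<in> D" for k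
    using that C0 C'(2) by (fastforce simp: D_def I_def K_def)
  have "D division_of \<Union>D"
  proof (rule division_ofI)
    show "finite D" by fact
    fix k assume "k \<in> D"
    then show "k \<subseteq> \<Union>D" "k \<noteq> {}" "\<exists>a b. k = cbox a b" using kD[of k] by (auto simp: cbox_interval)
    fix l assume "l \<in> D" "k \<noteq> l"
    with \<open>k \<in> D\<close> have "k \<inter> l = {}" using dis by (auto simp: pairwise_def disjnt_def)
    then show "interior k \<inter> interior l = {}" by (metis interior_Int interior_empty)
  qed simp
  moreover have "measure lebesgue (E - \<Union>D) < \<epsilon>"
  proof -
    have "\<Union>D' = E \<inter> \<Union>D" by (auto simp: C0(3) D_def)
    moreover have "\<Union>D \<in> sets lebesgue"
      using finD kD by (intro sets.finite_Union) fastforce+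
    then have "measure lebesgue (E - \<Union>D) = measure lebesgue E - measure lebesgue (E \<inter> \<Union>D)"
      using E Em measurable_measure_Diff[of E lebesgue "E \<inter> \<Union>D"]
      by (metis Diff_Int2 Int_lower1 inf.idem inf_commute sets.Int)
    ultimately show ?thesis using D'(3) mU by simp
  qed
  moreover have "\<Union>D \<subseteq> U" using kD by blast
  ultimately show ?thesis
    using that[of D] finD dis kD by blast
qed

lemma sum_lengths_division:
  fixes S :: "real set"
  assumes "d division_of S"
  shows "(\<Sum>k\<in>d. Sup k - Inf k) = measure lebesgue S"
  unfolding content_division[OF assms, symmetric]
proof (rule sum.cong)
  fix k assume "k \<in> d"
  then obtain a b where "k = {a..b}" "a \<le> b"
    using division_ofD(3,4)[OF assms] by (force simp: cbox_interval)
  then show "Sup k - Inf k = measure lebesgue k" by simp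
qed simp

section \<open>Points with prescribed slopes at arbitrarily small scales\<close>

definition finely :: "real \<Rightarrow> real \<Rightarrow> (real \<Rightarrow> real \<Rightarrow> bool) \<Rightarrow> real set"
  where "finely a b P =
    {x. \<forall>\<delta>>0. \<exists>y z. a \<le> y \<and> y < x \<and> x < z \<and> z \<le> b \<and> z - y < \<delta> \<and> P y z}"

lemma finely_subset: "finely a b P \<subseteq> {a<..<b}"
  by (fastforce simp: finely_def intro: zero_less_one)

text \<open>Since x lies strictly between y and z, the condition at scale 1 / (n + 1) defines a
  union of open intervals, whatever P is. The set is thus a countable intersection of open
  sets.\<close>

lemma finely_borel: "finely a b P \<in> sets borel"
proof -
  define S where "S n = (\<Union>(y, z)\<in>{(y, z). a \<le> y \<and> z \<le> b \<and> z - y < 1 / Suc n \<and> P y z}. {y<..<z})"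
    for n :: nat
  have "finely a b P = (\<Inter>n. S n)"
  proof (intro set_eqI iffI)
    fix x assume x: "x \<in> finely a b P"
    show "x \<in> (\<Inter>n. S n)"
    proof
      fix n
      have "(0::real) < 1 / Suc n" by simp
      then obtain y z where "a \<le> y" "y < x" "x < z" "z \<le> b" "z - y < 1 / Suc n" "P y z"
        using x unfolding finely_def by blast
      then show "x \<in> S n" by (auto simp: S_def)
    qed
  next
    fix x assume x: "x \<in> (\<Inter>n. S n)"
    show "x \<in> finely a b P"
      unfolding finely_def
    proof (intro CollectI allI impI)
      fix \<delta> :: real assume "\<delta> > 0"
      then obtain n where n: "1 / Suc n < \<delta>" by (metis nat_approx_posE)
      have "x \<in> S n" using x by auto
      then obtain y z where "a \<le> y" "y < x" "x < z" "z \<le> b" "z - y < 1 / Suc n" "P y z"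
        by (auto simp: S_def)
      with n show "\<exists>y z. a \<le> y \<and> y < x \<and> x < z \<and> z \<le> b \<and> z - y < \<delta> \<and> P y z"
        by (meson less_trans)
    qed
  qed
  moreover have "open (S n)" for n by (auto simp: S_def)
  ultimately show ?thesis by auto
qed

lemma finely_lmeasurable: "finely a b P \<in> lmeasurable"
proof (rule fmeasurableI2)
  show "finely a b P \<subseteq> {a..b}" using finely_subset[of a b P] by force
qed (auto simp: finely_borel)

text \<open>If \<open>f\<close> has slope at most \<open>\<alpha>\<close> on \<open>{c..d}\<close> but slopes at least \<open>\<beta>\<close> at all small scales around the
  points of \<open>E\<close>, then cutting out a Vitali family of steep intervals leaves a remainder of little
  more than the length of \<open>{c..d} - E\<close> that has to carry an increment of at least about
  \<open>(\<beta> - \<alpha>) * (d - c)\<close>.\<close>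

lemma slope_remainder:
  fixes f :: "real \<Rightarrow> real"
  assumes "c < d" and slope: "f d - f c \<le> \<alpha> * (d - c)" and E: "E \<in> sets lebesgue"
    and fine: "E \<subseteq> finely a b (\<lambda>y z. \<beta> * (z - y) \<le> f z - f y)" and "\<eta> > 0"
  obtains r where "r division_of \<Union>r" "\<Union>r \<subseteq> {c..d}"
    "(\<Sum>k\<in>r. Sup k - Inf k) \<le> measure lebesgue ({c..d} - E) + \<eta>"
    "(\<beta> - \<alpha>) * (d - c) \<le>
      (\<Sum>k\<in>r. \<bar>f (Sup k) - f (Inf k)\<bar>) + \<bar>\<beta>\<bar> * (\<Sum>k\<in>r. Sup k - Inf k)"
proof -
  define E' where "E' = {c<..<d} \<inter> E"
  have E'm: "E' \<in> lmeasurable"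
    unfolding E'_def by (rule fmeasurable_Int_fmeasurable[OF _ E]) simp
  obtain D where D: "finite D" "D division_of \<Union>D"
    "\<And>k. k \<in> D \<Longrightarrow> \<exists>y z. k = {y..z} \<and> y < z \<and> \<beta> * (z - y) \<le> f z - f y"
    "\<Union>D \<subseteq> {c<..<d}" "measure lebesgue (E' - \<Union>D) < \<eta>"
  proof (rule Vitali_covering_intervals[OF E'm, of "{c<..<d}" \<eta> "\<lambda>y z. \<beta> * (z - y) \<le> f z - f y"])
    show "\<exists>y z. y < x \<and> x < z \<and> z - y < \<delta> \<and> \<beta> * (z - y) \<le> f z - f y" if "x \<in> E'" "\<delta> > 0" for x \<delta>
      using fine that unfolding E'_def finely_def by blast
  qed (use \<open>\<eta> > 0\<close> in \<open>auto simp: E'_def\<close>)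
  have "\<Union>D \<subseteq> cbox c d" using D(4) by force
  then obtain q where q: "D \<subseteq> q" "q division_of cbox c d"
    using partial_division_extend_interval[OF D(2)] by blast
  have q': "q division_of {c..d}" using q by (simp add: cbox_interval)
  have finq: "finite q" using q by blast
  define r where "r = q - D"
  have r: "r division_of \<Union>r"
    using division_of_subset[of q r] q by (auto simp: r_def division_of_def)
  have rsub: "\<Union>r \<subseteq> {c..d}"
    using q' by (auto simp: r_def division_of_def)
  have split: "sum h q = sum h r + sum h D" for h :: "real set \<Rightarrow> real"
    unfolding r_def using q(1) finq by (simp add: sum.subset_diff)
  have Dm: "\<Union>D \<in> lmeasurable" using D(2) lmeasurable_division by blast
  have "d - c = measure lebesgue {c..d}" using \<open>c < d\<close> by simp
  also have "\<dots> = measure lebesgue ({c..d} - E) + measure lebesgue ({c..d} \<inter> E)"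
  proof -
    have *: "{c..d} \<inter> E \<in> lmeasurable" by (rule fmeasurable_Int_fmeasurable[OF _ E]) simp
    have "({c..d} \<inter> E) \<union> {c..d} = {c..d}" "{c..d} - {c..d} \<inter> E = {c..d} - E" by auto
    then show ?thesis using measure_Un2[OF *, of "{c..d}"] by simp
  qed
  finally have dc: "d - c = measure lebesgue ({c..d} - E) + measure lebesgue ({c..d} \<inter> E)" .
  have "measure lebesgue ({c..d} \<inter> E) = measure lebesgue E'"
    by (rule measure_negligible_symdiff[OF E'm])
      (rule negligible_subset[of "{c, d}"], auto simp: E'_def)
  also have "\<dots> \<le> measure lebesgue ((E' - \<Union>D) \<union> \<Union>D)"
    using E'm Dm by (intro measure_mono_fmeasurable) auto
  also have "\<dots> \<le> measure lebesgue (E' - \<Union>D) + measure lebesgue (\<Union>D)"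
    using E'm Dm by (intro measure_Un_le) auto
  finally have E2: "measure lebesgue ({c..d} \<inter> E) \<le> \<eta> + measure lebesgue (\<Union>D)"
    using D(5) by simp
  have lenq: "(\<Sum>k\<in>q. Sup k - Inf k) = d - c"
    using sum_increments_division[OF q', of "\<lambda>x. x"] \<open>c < d\<close> by simp
  have lenD: "(\<Sum>k\<in>D. Sup k - Inf k) = measure lebesgue (\<Union>D)"
    by (rule sum_lengths_division[OF D(2)])
  have incq: "(\<Sum>k\<in>q. f (Sup k) - f (Inf k)) = f d - f c"
    using sum_increments_division[OF q', of f] \<open>c < d\<close> by simp
  have incD: "\<beta> * (\<Sum>k\<in>D. Sup k - Inf k) \<le> (\<Sum>k\<in>D. f (Sup k) - f (Inf k))"
    unfolding sum_distrib_left by (intro sum_mono) (use D(3) in force)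
  define l where "l = (\<Sum>k\<in>r. Sup k - Inf k)"
  have l0: "l \<ge> 0" unfolding l_def
    using sum_lengths_division[OF r] by simp
  have l1: "(\<Sum>k\<in>D. Sup k - Inf k) = (d - c) - l"
    using split[of "\<lambda>k. Sup k - Inf k"] lenq by (simp add: l_def)
  have "(\<Sum>k\<in>r. f (Sup k) - f (Inf k)) \<ge> - (\<Sum>k\<in>r. \<bar>f (Sup k) - f (Inf k)\<bar>)"
    using sum_abs[of "\<lambda>k. f (Sup k) - f (Inf k)" r] by linarith
  moreover have "(\<Sum>k\<in>r. f (Sup k) - f (Inf k)) \<le> \<alpha> * (d - c) - \<beta> * ((d - c) - l)"
    using split[of "\<lambda>k. f (Sup k) - f (Inf k)"] incq incD slope unfolding l1 by linarith
  moreover have "\<beta> * l \<le> \<bar>\<beta>\<bar> * l" using l0 by (intro mult_right_mono) auto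
  ultimately have "(\<beta> - \<alpha>) * (d - c) \<le> (\<Sum>k\<in>r. \<bar>f (Sup k) - f (Inf k)\<bar>) + \<bar>\<beta>\<bar> * l"
    by (simp add: algebra_simps)
  moreover have "l \<le> measure lebesgue ({c..d} - E) + \<eta>"
    using dc E2 l1 lenD by simp
  ultimately show ?thesis using that[OF r rsub] by (simp add: l_def)
qed

section \<open>Exceptional slopes of absolutely continuous functions\<close>

lemma abs_cont_onD:
  assumes "abs_cont_on a b \<xi>" "\<epsilon> > 0"
  shows "\<exists>\<delta>>0. \<forall>d. d division_of \<Union>d \<longrightarrow> \<Union>d \<subseteq> {a..b} \<longrightarrow> (\<Sum>k\<in>d. Sup k - Inf k) < \<delta> \<longrightarrow>
      (\<Sum>k\<in>d. norm (\<xi> (Sup k) - \<xi> (Inf k))) < \<epsilon>"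
proof -
  obtain \<delta> where "\<delta> > 0" and \<delta>: "\<forall>d S. d division_of S \<and> S \<subseteq> {a..b} \<and> (\<Sum>k\<in>d. Sup k - Inf k) < \<delta> \<longrightarrow>
      (\<Sum>k\<in>d. norm (\<xi> (Sup k) - \<xi> (Inf k))) < \<epsilon>"
    using assms(1)[unfolded abs_cont_on_def, rule_format, OF assms(2)] by (elim exE conjE) (rule that)
  show ?thesis
    using \<open>\<delta> > 0\<close> \<delta>[rule_format, OF conjI, OF _ conjI] by (intro exI[of _ \<delta>]) simp
qed

lemma abs_cont_on_continuous:
  assumes "abs_cont_on a b \<xi>"
  shows "continuous_on {a..b} \<xi>"
  unfolding continuous_on_iff
proof (intro ballI allI impI)
  fix x \<epsilon> :: real assume x: "x \<in> {a..b}" and "\<epsilon> > 0"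
  obtain \<delta> where \<delta>0: "\<delta> > 0" and \<delta>1: "\<forall>d. d division_of \<Union>d \<longrightarrow> \<Union>d \<subseteq> {a..b} \<longrightarrow>
      (\<Sum>k\<in>d. Sup k - Inf k) < \<delta> \<longrightarrow> (\<Sum>k\<in>d. norm (\<xi> (Sup k) - \<xi> (Inf k))) < \<epsilon>"
    using abs_cont_onD[OF assms \<open>\<epsilon> > 0\<close>] by auto
  note \<delta> = \<delta>0 \<delta>1[rule_format]
  have *: "norm (\<xi> z - \<xi> y) < \<epsilon>" if "a \<le> y" "y \<le> z" "z \<le> b" "z - y < \<delta>" for y z
    using \<delta>(2)[of "{{y..z}}"] that division_of_self[of y z] by (simp add: cbox_interval)
  show "\<exists>d>0. \<forall>x'\<in>{a..b}. dist x' x < d \<longrightarrow> dist (\<xi> x') (\<xi> x) < \<epsilon>"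
  proof (intro exI conjI ballI impI)
    fix x' assume x': "x' \<in> {a..b}" "dist x' x < \<delta>"
    show "dist (\<xi> x') (\<xi> x) < \<epsilon>"
      using *[of x x'] *[of x' x] x x' by (cases "x \<le> x'") (auto simp: dist_norm norm_minus_commute)
  qed (rule \<delta>)
qed

text \<open>If the set E had measure m > 0, Vitali would give disjoint intervals of slope at most
  \<alpha> that capture half of E and stay in an open U barely larger than E. By
  \<open>slope_remainder\<close> each contains a remainder, and together these remainders have tiny
  length but carry an increment of about (\<beta> - \<alpha>) m / 2, against absolute
  continuity.\<close>

lemma finely_two_slopes_negligible:
  fixes f :: "real \<Rightarrow> real"
  assumes ac: "abs_cont_on a b f" and "\<alpha> < \<beta>"
  shows "negligible (finely a b (\<lambda>y z. f z - f y \<le> \<alpha> * (z - y)) \<inter>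
    finely a b (\<lambda>y z. \<beta> * (z - y) \<le> f z - f y))"
    (is "negligible ?E")
proof (rule ccontr)
  define E where "E = ?E"
  assume "\<not> negligible ?E"
  then have nE: "\<not> negligible E" by (simp add: E_def)
  have Em: "E \<in> lmeasurable"
    unfolding E_def by (intro fmeasurable_Int_fmeasurable finely_lmeasurable) (simp add: finely_borel)
  then have Es: "E \<in> sets lebesgue" by (rule fmeasurableD)
  define m where "m = measure lebesgue E"
  have m: "m > 0"
    using nE Em unfolding m_def negligible_iff_measure by (simp add: zero_less_measure_iff)
  \<comment> \<open>The intervals chosen below have total length at least m / 2, so \<kappa> bounds
    the accumulated slope gap from below.\<close>
  define \<kappa> where "\<kappa> = (\<beta> - \<alpha>) * m / 2"
  have \<kappa>: "\<kappa> > 0" using m \<open>\<alpha> < \<beta>\<close> by (simp add: \<kappa>_def)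
  obtain \<delta> where \<delta>0: "\<delta> > 0" and \<delta>1: "\<forall>d. d division_of \<Union>d \<longrightarrow> \<Union>d \<subseteq> {a..b} \<longrightarrow>
      (\<Sum>k\<in>d. Sup k - Inf k) < \<delta> \<longrightarrow> (\<Sum>k\<in>d. norm (f (Sup k) - f (Inf k))) < \<kappa> / 2"
    using abs_cont_onD[OF ac, of "\<kappa> / 2"] \<kappa> by auto
  note \<delta> = \<delta>0 \<delta>1[rule_format]
  \<comment> \<open>Below length \<delta>', absolute continuity keeps the increments under \<kappa>
    / 2, and the error term |\<beta>| times the length is also at most \<kappa> / 2.\<close>
  define \<delta>' where "\<delta>' = min \<delta> (\<kappa> / (2 * (\<bar>\<beta>\<bar> + 1)))"
  have \<delta>': "\<delta>' > 0" "\<delta>' \<le> \<delta>" using \<delta> \<kappa> by (auto simp: \<delta>'_def)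
  have "\<bar>\<beta>\<bar> * \<delta>' \<le> (\<bar>\<beta>\<bar> + 1) * (\<kappa> / (2 * (\<bar>\<beta>\<bar> + 1)))"
    using \<delta>' by (intro mult_mono) (auto simp: \<delta>'_def)
  also have "\<dots> = \<kappa> / 2" by (simp add: field_simps add_nonneg_eq_0_iff)
  finally have \<beta>\<delta>': "\<bar>\<beta>\<bar> * \<delta>' \<le> \<kappa> / 2" .
  obtain U where U: "open U" "E \<subseteq> U" "U - E \<in> lmeasurable" "emeasure lebesgue (U - E) < ennreal (\<delta>' / 2)"
    using sets_lebesgue_outer_open[OF Es, of "\<delta>' / 2"] \<delta>' by auto
  have mUE: "measure lebesgue (U - E) < \<delta>' / 2"
    using U(3,4) \<delta>' by (simp add: emeasure_eq_measure2 ennreal_less_iff)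
  have Eab: "E \<subseteq> {a<..<b}" unfolding E_def using finely_subset by blast
  obtain C where C: "finite C" "C division_of \<Union>C" "pairwise disjnt C"
    "\<And>k. k \<in> C \<Longrightarrow> \<exists>y z. k = {y..z} \<and> y < z \<and> f z - f y \<le> \<alpha> * (z - y)"
    "\<Union>C \<subseteq> U \<inter> {a<..<b}" "measure lebesgue (E - \<Union>C) < m / 2"
  proof (rule Vitali_covering_intervals[OF Em, of "U \<inter> {a<..<b}" "m / 2" "\<lambda>y z. f z - f y \<le> \<alpha> * (z - y)"])
    show "\<exists>y z. y < x \<and> x < z \<and> z - y < \<delta> \<and> f z - f y \<le> \<alpha> * (z - y)" if "x \<in> E" "\<delta> > 0" for x \<delta>
      using that unfolding E_def finely_def by blast
  qed (use U m Eab in auto)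
  \<comment> \<open>One error \<eta> is spent per interval of C; all of them together stay below
    \<delta>' / 2, the other half of \<delta>' being taken by U - E.\<close>
  define \<eta> where "\<eta> = \<delta>' / (4 * (real (card C) + 1))"
  have \<eta>: "\<eta> > 0" using \<delta>' by (simp add: \<eta>_def)
  have c\<eta>: "real (card C) * \<eta> < \<delta>' / 2"
    using \<delta>' by (simp add: \<eta>_def field_simps add_pos_nonneg)
  have "\<exists>r. r division_of \<Union>r \<and> \<Union>r \<subseteq> I \<and>
    (\<Sum>k\<in>r. Sup k - Inf k) \<le> measure lebesgue (I - E) + \<eta> \<and>
    (\<beta> - \<alpha>) * (Sup I - Inf I) \<le>
      (\<Sum>k\<in>r. \<bar>f (Sup k) - f (Inf k)\<bar>) + \<bar>\<beta>\<bar> * (\<Sum>k\<in>r. Sup k - Inf k)" if I: "I \<in> C" for I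
  proof -
    obtain y z where yz: "I = {y..z}" "y < z" "f z - f y \<le> \<alpha> * (z - y)" using C(4)[OF I] by auto
    have sub: "E \<subseteq> finely a b (\<lambda>y z. \<beta> * (z - y) \<le> f z - f y)" by (auto simp: E_def)
    obtain r where "r division_of \<Union>r" "\<Union>r \<subseteq> {y..z}"
      "(\<Sum>k\<in>r. Sup k - Inf k) \<le> measure lebesgue ({y..z} - E) + \<eta>"
      "(\<beta> - \<alpha>) * (z - y) \<le>
        (\<Sum>k\<in>r. \<bar>f (Sup k) - f (Inf k)\<bar>) + \<bar>\<beta>\<bar> * (\<Sum>k\<in>r. Sup k - Inf k)"
      by (rule slope_remainder[OF yz(2,3) Es sub \<eta>])
    then show ?thesis using yz(1,2) by (intro exI[of _ r]) simp
  qed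
  then have "\<forall>I\<in>C. \<exists>r. r division_of \<Union>r \<and> \<Union>r \<subseteq> I \<and>
    (\<Sum>k\<in>r. Sup k - Inf k) \<le> measure lebesgue (I - E) + \<eta> \<and>
    (\<beta> - \<alpha>) * (Sup I - Inf I) \<le>
      (\<Sum>k\<in>r. \<bar>f (Sup k) - f (Inf k)\<bar>) + \<bar>\<beta>\<bar> * (\<Sum>k\<in>r. Sup k - Inf k)"
    by (rule ballI)
  from bchoice[OF this] obtain r where r0: "\<And>I. I \<in> C \<Longrightarrow> r I division_of \<Union>(r I) \<and> \<Union>(r I) \<subseteq> I \<and>
    (\<Sum>k\<in>r I. Sup k - Inf k) \<le> measure lebesgue (I - E) + \<eta> \<and>
    (\<beta> - \<alpha>) * (Sup I - Inf I) \<le>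
      (\<Sum>k\<in>r I. \<bar>f (Sup k) - f (Inf k)\<bar>) + \<bar>\<beta>\<bar> * (\<Sum>k\<in>r I. Sup k - Inf k)" by blast
  note r = r0[THEN conjunct1] r0[THEN conjunct2, THEN conjunct1]
    r0[THEN conjunct2, THEN conjunct2, THEN conjunct1] r0[THEN conjunct2, THEN conjunct2, THEN conjunct2]
  have disj: "k \<inter> l = {}" if "I \<in> C" "J \<in> C" "I \<noteq> J" "k \<in> r I" "l \<in> r J" for I J k l
  proof -
    have "I \<inter> J = {}" using C(3) that by (auto simp: pairwise_def disjnt_def)
    then show ?thesis using r(2)[OF that(1)] r(2)[OF that(2)] that by blast
  qed
  define R where "R = (\<Union>I\<in>C. r I)"
  have finr: "finite (r I)" if "I \<in> C" for I using r(1)[OF that] by blast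
  have R: "R division_of \<Union>R"
  proof (rule division_ofI)
    show "finite R" using C(1) finr by (auto simp: R_def)
    fix k assume "k \<in> R"
    then obtain I where I: "I \<in> C" "k \<in> r I" by (auto simp: R_def)
    show "k \<subseteq> \<Union>R" using \<open>k \<in> R\<close> by auto
    show "k \<noteq> {}" "\<exists>a b. k = cbox a b" using r(1)[OF I(1)] I(2) by (auto simp: division_of_def)
    fix l assume "l \<in> R" "k \<noteq> l"
    then obtain J where J: "J \<in> C" "l \<in> r J" by (auto simp: R_def)
    show "interior k \<inter> interior l = {}"
    proof (cases "I = J")
      case True
      then show ?thesis using division_ofD(5)[OF r(1)[OF I(1)]] I J \<open>k \<noteq> l\<close> by auto
    next
      case False
      then show ?thesis using disj[of I J k l] I J by (metis interior_Int interior_empty)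
    qed
  qed simp
  have sumR: "sum h R = (\<Sum>I\<in>C. sum h (r I))" for h :: "real set \<Rightarrow> real"
    unfolding R_def
  proof (rule sum.UNION_disjoint)
    show "\<forall>I\<in>C. \<forall>J\<in>C. I \<noteq> J \<longrightarrow> r I \<inter> r J = {}"
    proof (intro ballI impI)
      fix I J assume IJ: "I \<in> C" "J \<in> C" "I \<noteq> J"
      have "k \<noteq> {}" if "k \<in> r I" for k using r(1)[OF IJ(1)] that by (auto simp: division_of_def)
      then show "r I \<inter> r J = {}" using disj[OF IJ] by (metis disjoint_iff inf.idem)
    qed
  qed (use C finr in auto)
  have mI: "I - E \<in> lmeasurable" if "I \<in> C" for I
    using C(4)[OF that] Es by (metis fmeasurable_Diff lmeasurable_cbox cbox_interval)
  have "(\<Sum>I\<in>C. measure lebesgue (I - E)) = measure lebesgue (\<Union>((\<lambda>I. I - E) ` C))"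
  proof (rule measure_negligible_finite_Union_image[symmetric])
    show "pairwise (\<lambda>x y. negligible ((x - E) \<inter> (y - E))) C"
    proof (rule pairwiseI)
      fix x y assume "x \<in> C" "y \<in> C" "x \<noteq> y"
      then have "x \<inter> y = {}" using C(3) by (auto simp: pairwise_def disjnt_def)
      then have "(x - E) \<inter> (y - E) = {}" by blast
      then show "negligible ((x - E) \<inter> (y - E))" by simp
    qed
  qed (use C mI in auto)
  also have "\<dots> \<le> measure lebesgue (U - E)"
  proof (rule measure_mono_fmeasurable)
    show "(\<Union>I\<in>C. I - E) \<in> sets lebesgue"
      by (rule sets.finite_UN[OF C(1) fmeasurableD[OF mI]])
  qed (use C(5) U(3) in auto)
  finally have mIE: "(\<Sum>I\<in>C. measure lebesgue (I - E)) < \<delta>' / 2" using mUE by simp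
  have "(\<Sum>k\<in>R. Sup k - Inf k) \<le> (\<Sum>I\<in>C. measure lebesgue (I - E) + \<eta>)"
    unfolding sumR by (intro sum_mono r)
  also have "\<dots> = (\<Sum>I\<in>C. measure lebesgue (I - E)) + real (card C) * \<eta>" by (simp add: sum.distrib)
  finally have lenR: "(\<Sum>k\<in>R. Sup k - Inf k) < \<delta>'" using mIE c\<eta> by simp
  have "\<Union>R \<subseteq> {a..b}" using r(2) C(5) by (fastforce simp: R_def)
  then have incR: "(\<Sum>k\<in>R. \<bar>f (Sup k) - f (Inf k)\<bar>) < \<kappa> / 2"
    using \<delta>(2)[OF R] lenR \<delta>' by simp
  have "\<bar>\<beta>\<bar> * (\<Sum>k\<in>R. Sup k - Inf k) \<le> \<bar>\<beta>\<bar> * \<delta>'"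
    using lenR by (intro mult_left_mono) auto
  moreover have "(\<beta> - \<alpha>) * (\<Sum>I\<in>C. Sup I - Inf I) \<le>
      (\<Sum>k\<in>R. \<bar>f (Sup k) - f (Inf k)\<bar>) + \<bar>\<beta>\<bar> * (\<Sum>k\<in>R. Sup k - Inf k)"
    unfolding sumR sum_distrib_left sum.distrib[symmetric]
    by (intro sum_mono) (use r(4) in \<open>simp add: sum_distrib_left sum.distrib\<close>)
  ultimately have upper: "(\<beta> - \<alpha>) * (\<Sum>I\<in>C. Sup I - Inf I) < \<kappa>"
    using \<beta>\<delta>' incR by linarith
  have Cm: "\<Union>C \<in> lmeasurable" using C(2) lmeasurable_division by blast
  have "m \<le> measure lebesgue ((E - \<Union>C) \<union> \<Union>C)"
    unfolding m_def using Em Cm by (intro measure_mono_fmeasurable) auto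
  also have "\<dots> \<le> measure lebesgue (E - \<Union>C) + measure lebesgue (\<Union>C)"
    using Em Cm by (intro measure_Un_le) auto
  finally have "m / 2 \<le> (\<Sum>I\<in>C. Sup I - Inf I)"
    using C(6) sum_lengths_division[OF C(2)] by simp
  then have "\<kappa> \<le> (\<beta> - \<alpha>) * (\<Sum>I\<in>C. Sup I - Inf I)"
    using mult_left_mono[of "m / 2" _ "\<beta> - \<alpha>"] \<open>\<alpha> < \<beta>\<close> unfolding \<kappa>_def by fastforce
  with upper show False by simp
qed

text \<open>Inside a window shorter than \<delta>, disjoint intervals have increments of total size
  below 1. If E had measure m > 0 there, Vitali intervals of slope at least M and total length at
  least m / 2 would exceed this bound for large M.\<close>

lemma finely_unbounded_slope_negligible:
  fixes f :: "real \<Rightarrow> real"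
  assumes ac: "abs_cont_on a b f"
  shows "negligible (\<Inter>M::nat. finely a b (\<lambda>y z. real M * (z - y) \<le> \<bar>f z - f y\<bar>))"
    (is "negligible ?E")
proof -
  define E where "E = ?E"
  have Es: "E \<in> sets lebesgue"
    unfolding E_def by (intro sets.countable_INT) (auto simp: finely_borel)
  obtain \<delta> where \<delta>0: "\<delta> > 0" and \<delta>1: "\<forall>d. d division_of \<Union>d \<longrightarrow> \<Union>d \<subseteq> {a..b} \<longrightarrow>
      (\<Sum>k\<in>d. Sup k - Inf k) < \<delta> \<longrightarrow> (\<Sum>k\<in>d. norm (f (Sup k) - f (Inf k))) < 1"
    using abs_cont_onD[OF ac, of 1] by auto
  note \<delta> = \<delta>0 \<delta>1[rule_format]
  \<comment> \<open>Open windows of length \<delta> / 2 at spacing \<delta> / 4 overlap, so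
    countably many cover the line.\<close>
  define J where "J j = {\<delta> / 4 * real_of_int j<..<\<delta> / 4 * real_of_int j + \<delta> / 2}" for j
  have neg: "negligible (J j \<inter> E)" for j
  proof (rule ccontr)
    assume n: "\<not> negligible (J j \<inter> E)"
    have Fm: "J j \<inter> E \<in> lmeasurable"
      by (rule fmeasurable_Int_fmeasurable[OF _ Es]) (simp add: J_def)
    define m where "m = measure lebesgue (J j \<inter> E)"
    have m: "m > 0"
      using n Fm unfolding m_def negligible_iff_measure by (simp add: zero_less_measure_iff)
    obtain M :: nat where M: "2 / m < real M" using reals_Archimedean2 by blast
    have sub: "E \<subseteq> finely a b (\<lambda>y z. real M * (z - y) \<le> \<bar>f z - f y\<bar>)"
      unfolding E_def by blast
    obtain C where C: "finite C" "C division_of \<Union>C"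
      "\<And>k. k \<in> C \<Longrightarrow> \<exists>y z. k = {y..z} \<and> y < z \<and> real M * (z - y) \<le> \<bar>f z - f y\<bar>"
      "\<Union>C \<subseteq> J j \<inter> {a<..<b}" "measure lebesgue (J j \<inter> E - \<Union>C) < m / 2"
    proof (rule Vitali_covering_intervals[OF Fm, of "J j \<inter> {a<..<b}" "m / 2"
          "\<lambda>y z. real M * (z - y) \<le> \<bar>f z - f y\<bar>"])
      show "\<exists>y z. y < x \<and> x < z \<and> z - y < \<delta> \<and> real M * (z - y) \<le> \<bar>f z - f y\<bar>"
        if "x \<in> J j \<inter> E" "\<delta> > 0" for x \<delta>
        using that sub unfolding finely_def by blast
      show "J j \<inter> E \<subseteq> J j \<inter> {a<..<b}" using sub finely_subset by blast
    qed (use m in \<open>auto simp: J_def\<close>)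
    have Cm: "\<Union>C \<in> lmeasurable" using C(2) lmeasurable_division by blast
    have "measure lebesgue (\<Union>C) \<le> measure lebesgue (J j)"
      using C(4) Cm by (intro measure_mono_fmeasurable) (auto simp: J_def)
    also have "\<dots> < \<delta>" using \<delta> by (simp add: J_def)
    finally have len: "(\<Sum>k\<in>C. Sup k - Inf k) < \<delta>" using sum_lengths_division[OF C(2)] by simp
    have "\<Union>C \<subseteq> {a..b}" using C(4) by fastforce
    then have inc: "(\<Sum>k\<in>C. \<bar>f (Sup k) - f (Inf k)\<bar>) < 1" using \<delta>(2)[OF C(2)] len by simp
    have "m \<le> measure lebesgue ((J j \<inter> E - \<Union>C) \<union> \<Union>C)"
      unfolding m_def using Fm Cm by (intro measure_mono_fmeasurable) auto
    also have "\<dots> \<le> measure lebesgue (J j \<inter> E - \<Union>C) + measure lebesgue (\<Union>C)"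
      using Fm Cm by (intro measure_Un_le) auto
    finally have "m / 2 \<le> (\<Sum>k\<in>C. Sup k - Inf k)"
      using C(5) sum_lengths_division[OF C(2)] by simp
    then have "real M * (m / 2) \<le> real M * (\<Sum>k\<in>C. Sup k - Inf k)"
      by (intro mult_left_mono) auto
    also have "\<dots> \<le> (\<Sum>k\<in>C. \<bar>f (Sup k) - f (Inf k)\<bar>)"
      unfolding sum_distrib_left by (intro sum_mono) (use C(3) in force)
    finally have "real M * (m / 2) < 1" using inc by simp
    with M m show False by (simp add: field_simps)
  qed
  have "E \<subseteq> (\<Union>j. J j \<inter> E)"
  proof
    fix x assume "x \<in> E"
    moreover have "x \<in> J (\<lceil>4 * x / \<delta>\<rceil> - 1)"
    proof -
      have "of_int \<lceil>4 * x / \<delta>\<rceil> - 1 < 4 * x / \<delta>" "4 * x / \<delta> \<le> of_int \<lceil>4 * x / \<delta>\<rceil>" by linarith+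
      then have "(of_int \<lceil>4 * x / \<delta>\<rceil> - 1) * \<delta> < 4 * x" "4 * x \<le> of_int \<lceil>4 * x / \<delta>\<rceil> * \<delta>"
        by (simp_all only: pos_less_divide_eq[OF \<delta>(1)] pos_divide_le_eq[OF \<delta>(1)])
      then show ?thesis using \<delta>(1) by (simp add: J_def algebra_simps)
    qed
    ultimately show "x \<in> (\<Union>j. J j \<inter> E)" by blast
  qed
  moreover have "negligible (\<Union>j. J j \<inter> E)"
    using neg by (intro negligible_countable_Union) auto
  ultimately show ?thesis unfolding E_def[symmetric] using negligible_subset by blast
qed

text \<open>The derivative is the infimum of the eventual upper bounds for slopes over intervals
  straddling x. \<open>bdd\<close> makes it finite; \<open>two\<close> forbids smaller slopes from
  recurring at all scales, so the straddling slopes converge. Continuity then allows one endpoint to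
  move to x.\<close>

lemma finely_imp_real_differentiable:
  fixes f :: "real \<Rightarrow> real"
  assumes cont: "continuous_on {a..b} f" and x: "x \<in> {a<..<b}"
    and bdd: "x \<notin> finely a b (\<lambda>y z. real M * (z - y) \<le> \<bar>f z - f y\<bar>)"
    and two: "\<And>\<alpha> \<beta>. \<alpha> \<in> \<rat> \<Longrightarrow> \<beta> \<in> \<rat> \<Longrightarrow> \<alpha> < \<beta> \<Longrightarrow>
      x \<notin> finely a b (\<lambda>y z. f z - f y \<le> \<alpha> * (z - y)) \<inter>
          finely a b (\<lambda>y z. \<beta> * (z - y) \<le> f z - f y)"
  shows "\<exists>l. (f has_real_derivative l) (at x)"
proof -
  define near where "near \<delta> y z \<longleftrightarrow> a \<le> y \<and> y < x \<and> x < z \<and> z \<le> b \<and> z - y < \<delta>" for \<delta> y z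
  have notfine: "x \<notin> finely a b P \<longleftrightarrow> (\<exists>\<delta>>0. \<forall>y z. near \<delta> y z \<longrightarrow> \<not> P y z)" for P
    unfolding finely_def near_def by blast
  define A where "A = {c. \<exists>\<delta>>0. \<forall>y z. near \<delta> y z \<longrightarrow> f z - f y \<le> c * (z - y)}"
  obtain \<delta>0 where \<delta>0: "\<delta>0 > 0" "\<And>y z. near \<delta>0 y z \<Longrightarrow> \<bar>f z - f y\<bar> < real M * (z - y)"
    using bdd unfolding notfine not_le by blast
  have "f z - f y \<le> real M * (z - y)" if "near \<delta>0 y z" for y z using \<delta>0(2)[OF that] by linarith
  then have MA: "real M \<in> A" unfolding A_def using \<delta>0(1) by blast
  have ex: "\<exists>y z. near \<delta> y z" if "\<delta> > 0" for \<delta>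
  proof (intro exI)
    show "near \<delta> (max a (x - \<delta> / 3)) (min b (x + \<delta> / 3))" using x that by (auto simp: near_def max_def min_def)
  qed
  have lb: "- real M \<le> c" if c: "c \<in> A" for c
  proof -
    obtain \<delta> where \<delta>: "\<delta> > 0" "\<And>y z. near \<delta> y z \<Longrightarrow> f z - f y \<le> c * (z - y)"
      using c unfolding A_def by blast
    obtain y z where yz: "near (min \<delta> \<delta>0) y z" using ex[of "min \<delta> \<delta>0"] \<delta> \<delta>0 by auto
    then have "near \<delta> y z" "near \<delta>0 y z" "z - y > 0" by (auto simp: near_def)
    then have "- real M * (z - y) \<le> c * (z - y)" using \<delta>(2)[of y z] \<delta>0(2)[of y z] by auto
    then show ?thesis using \<open>z - y > 0\<close> by (simp only: mult_le_cancel_right_pos)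
  qed
  then have bA: "bdd_below A" by (intro bdd_belowI)
  define l where "l = Inf A"
  have two_sided: "\<exists>\<delta>>0. \<forall>y z. near \<delta> y z \<longrightarrow> \<bar>f z - f y - l * (z - y)\<bar> \<le> \<epsilon> * (z - y)" if \<epsilon>: "\<epsilon> > 0" for \<epsilon>
  proof -
    obtain c where c: "c \<in> A" "c < l + \<epsilon>"
      using cInf_lessD[of A "l + \<epsilon>"] MA \<epsilon> by (auto simp: l_def)
    then obtain \<delta>1 where \<delta>1: "\<delta>1 > 0" "\<And>y z. near \<delta>1 y z \<Longrightarrow> f z - f y \<le> c * (z - y)"
      unfolding A_def by blast
    obtain \<beta> where \<beta>: "\<beta> \<in> \<rat>" "l - \<epsilon> < \<beta>" "\<beta> < l" using Rats_dense_in_real[of "l - \<epsilon>" l] \<epsilon> by auto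
    obtain \<alpha> where \<alpha>: "\<alpha> \<in> \<rat>" "l - \<epsilon> < \<alpha>" "\<alpha> < \<beta>" using Rats_dense_in_real[of "l - \<epsilon>" \<beta>] \<beta> by auto
    \<comment> \<open>Below the infimum, \<beta> is not an eventual upper bound, so slopes at least
      \<beta> recur at all scales. Then \<open>two\<close> excludes slopes at most \<alpha> from
      some scale on.\<close>
    have "\<beta> \<notin> A" using \<beta>(3) cInf_lower[OF _ bA, of \<beta>] by (auto simp: l_def)
    have "x \<in> finely a b (\<lambda>y z. \<beta> * (z - y) \<le> f z - f y)"
    proof (rule ccontr)
      assume "x \<notin> finely a b (\<lambda>y z. \<beta> * (z - y) \<le> f z - f y)"
      then obtain \<delta> where "\<delta> > 0" "\<And>y z. near \<delta> y z \<Longrightarrow> f z - f y < \<beta> * (z - y)"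
        unfolding notfine not_le by blast
      then have "\<beta> \<in> A" unfolding A_def by (blast intro: less_imp_le)
      with \<open>\<beta> \<notin> A\<close> show False by contradiction
    qed
    then have "x \<notin> finely a b (\<lambda>y z. f z - f y \<le> \<alpha> * (z - y))" using two[OF \<alpha>(1) \<beta>(1) \<alpha>(3)] by auto
    then obtain \<delta>2 where \<delta>2: "\<delta>2 > 0" "\<And>y z. near \<delta>2 y z \<Longrightarrow> \<alpha> * (z - y) < f z - f y"
      unfolding notfine not_le by blast
    have "\<bar>f z - f y - l * (z - y)\<bar> \<le> \<epsilon> * (z - y)" if n: "near (min \<delta>1 \<delta>2) y z" for y z
    proof -
      have n': "near \<delta>1 y z" "near \<delta>2 y z" "z - y > 0" using n by (auto simp: near_def)
      have "c * (z - y) \<le> (l + \<epsilon>) * (z - y)" "(l - \<epsilon>) * (z - y) \<le> \<alpha> * (z - y)"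
        using c \<alpha> n'(3) by (auto intro!: mult_right_mono)
      then show ?thesis using \<delta>1(2)[OF n'(1)] \<delta>2(2)[OF n'(2)] by (simp add: abs_le_iff algebra_simps)
    qed
    then show ?thesis using \<delta>1(1) \<delta>2(1) by (intro exI[of _ "min \<delta>1 \<delta>2"]) auto
  qed
  have cx: "isCont f x"
    using cont x continuous_on_interior[of "{a..b}" f x] by (simp add: interior_atLeastAtMost_real)
  have "(f has_derivative (\<lambda>h. l * h)) (at x)"
    unfolding has_derivative_at_alt
  proof (intro conjI allI impI)
    show "bounded_linear ((*) l)" by (rule bounded_linear_mult_right)
    fix \<epsilon> :: real assume \<epsilon>: "\<epsilon> > 0"
    obtain \<delta> where \<delta>: "\<delta> > 0" "\<And>y z. near \<delta> y z \<Longrightarrow> \<bar>f z - f y - l * (z - y)\<bar> \<le> \<epsilon> * (z - y)"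
      using two_sided[OF \<epsilon>] by blast
    define d where "d = min (\<delta> / 2) (min (x - a) (b - x))"
    have d: "d > 0" "d \<le> \<delta> / 2" "d \<le> x - a" "d \<le> b - x" using \<delta> x by (auto simp: d_def min_def)
    \<comment> \<open>Letting y tend to x from the left turns the estimate for [y, z] into one for
      [x, z].\<close>
    have right: "\<bar>f z - f x - l * (z - x)\<bar> \<le> \<epsilon> * (z - x)" if z: "x < z" "z - x < d" for z
    proof (rule tendsto_le[of "at_left x"])
      show "((\<lambda>y. \<epsilon> * (z - y)) \<longlongrightarrow> \<epsilon> * (z - x)) (at_left x)" by (intro tendsto_intros)
      show "((\<lambda>y. \<bar>f z - f y - l * (z - y)\<bar>) \<longlongrightarrow> \<bar>f z - f x - l * (z - x)\<bar>) (at_left x)"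
        by (intro tendsto_intros) (use cx in \<open>auto simp: isCont_def filterlim_at_split\<close>)
      have "\<forall>\<^sub>F y in at_left x. y \<in> {x - d<..<x}"
        by (rule eventually_at_leftI[of "x - d"]) (use d in auto)
      then show "\<forall>\<^sub>F y in at_left x. \<bar>f z - f y - l * (z - y)\<bar> \<le> \<epsilon> * (z - y)"
      proof eventually_elim
        case (elim y)
        then show ?case using z d by (intro \<delta>) (auto simp: near_def)
      qed
    qed simp
    have left: "\<bar>f x - f y - l * (x - y)\<bar> \<le> \<epsilon> * (x - y)" if y: "y < x" "x - y < d" for y
    proof (rule tendsto_le[of "at_right x"])
      show "((\<lambda>z. \<epsilon> * (z - y)) \<longlongrightarrow> \<epsilon> * (x - y)) (at_right x)" by (intro tendsto_intros)
      show "((\<lambda>z. \<bar>f z - f y - l * (z - y)\<bar>) \<longlongrightarrow> \<bar>f x - f y - l * (x - y)\<bar>) (at_right x)"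
        by (intro tendsto_intros) (use cx in \<open>auto simp: isCont_def filterlim_at_split\<close>)
      have "\<forall>\<^sub>F z in at_right x. z \<in> {x<..<x + d}"
        by (rule eventually_at_rightI[of _ "x + d"]) (use d in auto)
      then show "\<forall>\<^sub>F z in at_right x. \<bar>f z - f y - l * (z - y)\<bar> \<le> \<epsilon> * (z - y)"
      proof eventually_elim
        case (elim z)
        then show ?case using y d by (intro \<delta>) (auto simp: near_def)
      qed
    qed simp
    show "\<exists>d>0. \<forall>y. norm (y - x) < d \<longrightarrow> norm (f y - f x - l * (y - x)) \<le> \<epsilon> * norm (y - x)"
    proof (intro exI conjI allI impI)
      fix y assume y: "norm (y - x) < d"
      consider "y < x" | "y = x" | "x < y" by linarith
      then show "norm (f y - f x - l * (y - x)) \<le> \<epsilon> * norm (y - x)"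
      proof cases
        case 1
        have "f y - f x - l * (y - x) = - (f x - f y - l * (x - y))" by (simp add: algebra_simps)
        then show ?thesis using left[of y] 1 y by (simp only: real_norm_def abs_minus_cancel) simp
      next
        case 3
        then show ?thesis using right[of y] y by simp
      qed simp
    qed (rule d)
  qed
  then show ?thesis by (auto simp: has_field_derivative_def)
qed

lemma abs_cont_on_AE_real_differentiable:
  fixes f :: "real \<Rightarrow> real"
  assumes ac: "abs_cont_on a b f"
  obtains N where "negligible N" "\<And>x. x \<in> {a<..<b} - N \<Longrightarrow> \<exists>l. (f has_real_derivative l) (at x)"
proof
  let ?E = "\<lambda>(\<alpha>, \<beta>). finely a b (\<lambda>y z. f z - f y \<le> \<alpha> * (z - y)) \<inter>
    finely a b (\<lambda>y z. \<beta> * (z - y) \<le> f z - f y)"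
  let ?Q = "{(\<alpha>, \<beta>). \<alpha> \<in> \<rat> \<and> \<beta> \<in> \<rat> \<and> \<alpha> < \<beta>}"
  let ?I = "\<Inter>M::nat. finely a b (\<lambda>y z. real M * (z - y) \<le> \<bar>f z - f y\<bar>)"
  \<comment> \<open>Restricting to rational pairs of slopes keeps the exceptional set a countable
    union of null sets.\<close>
  have "?Q \<subseteq> \<rat> \<times> \<rat>" by auto
  then have "countable ?Q" by (rule countable_subset) (simp add: countable_rat)
  then show "negligible (\<Union>(?E ` ?Q) \<union> ?I)"
    using finely_two_slopes_negligible[OF ac] finely_unbounded_slope_negligible[OF ac]
    by (intro negligible_Un negligible_countable_Union) auto
  fix x assume x: "x \<in> {a<..<b} - (\<Union>(?E ` ?Q) \<union> ?I)"
  then obtain M :: nat where M: "x \<notin> finely a b (\<lambda>y z. real M * (z - y) \<le> \<bar>f z - f y\<bar>)" by blast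
  show "\<exists>l. (f has_real_derivative l) (at x)"
    by (rule finely_imp_real_differentiable[OF abs_cont_on_continuous[OF ac] _ M]) (use x in auto)
qed

section \<open>Vector-valued curves and indefinite integrals\<close>

lemma abs_cont_on_linear_contraction:
  assumes "abs_cont_on a b \<xi>" "\<And>v. norm (L v) \<le> norm v" "\<And>v w. L (v - w) = L v - L w"
  shows "abs_cont_on a b (\<lambda>x. L (\<xi> x))"
  unfolding abs_cont_on_def
proof (intro allI impI)
  fix \<epsilon> :: real assume "\<epsilon> > 0"
  then obtain \<delta> where \<delta>0: "\<delta> > 0" and \<delta>1: "\<forall>d. d division_of \<Union>d \<longrightarrow> \<Union>d \<subseteq> {a..b} \<longrightarrow>
      (\<Sum>k\<in>d. Sup k - Inf k) < \<delta> \<longrightarrow> (\<Sum>k\<in>d. norm (\<xi> (Sup k) - \<xi> (Inf k))) < \<epsilon>"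
    using abs_cont_onD[OF assms(1), of \<epsilon>] by auto
  note \<delta> = \<delta>0 \<delta>1[rule_format]
  show "\<exists>\<delta>>0. \<forall>d S. d division_of S \<and> S \<subseteq> {a..b} \<and> (\<Sum>k\<in>d. Sup k - Inf k) < \<delta> \<longrightarrow>
    (\<Sum>k\<in>d. norm (L (\<xi> (Sup k)) - L (\<xi> (Inf k)))) < \<epsilon>"
  proof (intro exI conjI allI impI)
    fix d and S :: "real set"
    assume d: "d division_of S \<and> S \<subseteq> {a..b} \<and> (\<Sum>k\<in>d. Sup k - Inf k) < \<delta>"
    then have "S = \<Union>d" by (simp add: division_of_def)
    have "(\<Sum>k\<in>d. norm (L (\<xi> (Sup k)) - L (\<xi> (Inf k)))) \<le> (\<Sum>k\<in>d. norm (\<xi> (Sup k) - \<xi> (Inf k)))"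
      by (intro sum_mono) (metis assms(2,3))
    also have "\<dots> < \<epsilon>" using d \<delta>(2)[of d] \<open>S = \<Union>d\<close> by auto
    finally show "(\<Sum>k\<in>d. norm (L (\<xi> (Sup k)) - L (\<xi> (Inf k)))) < \<epsilon>" .
  qed (rule \<delta>)
qed

lemma abs_cont_on_AE_differentiable:
  fixes \<xi> :: "real \<Rightarrow> real ^ 'n"
  assumes ac: "abs_cont_on a b \<xi>"
  obtains N where "negligible N" "\<And>x. x \<in> {a<..<b} - N \<Longrightarrow> \<exists>q. (\<xi> has_vector_derivative q) (at x)"
proof -
  have "\<exists>N. negligible N \<and> (\<forall>x \<in> {a<..<b} - N. \<exists>l. ((\<lambda>x. \<xi> x $ i) has_real_derivative l) (at x))" for i
  proof -
    have "abs_cont_on a b (\<lambda>x. \<xi> x $ i)"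
      by (rule abs_cont_on_linear_contraction[OF ac]) (auto simp: component_le_norm_cart)
    then show ?thesis using abs_cont_on_AE_real_differentiable by metis
  qed
  then obtain N where N: "\<And>i. negligible (N i)"
    "\<And>i x. x \<in> {a<..<b} - N i \<Longrightarrow> \<exists>l. ((\<lambda>x. \<xi> x $ i) has_real_derivative l) (at x)"
    by metis
  show ?thesis
  proof
    show "negligible (\<Union>i. N i)" using N(1) by (intro negligible_countable_Union) auto
    fix x assume "x \<in> {a<..<b} - (\<Union>i. N i)"
    then have "\<forall>i. \<exists>l. ((\<lambda>x. \<xi> x $ i) has_real_derivative l) (at x)" using N(2) by blast
    then obtain q where q: "\<And>i. ((\<lambda>x. \<xi> x $ i) has_real_derivative q i) (at x)" by metis
    have "(\<xi> has_derivative (\<lambda>h. h *\<^sub>R (\<chi> i. q i))) (at x)"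
    proof (rule iffD2[OF has_derivative_componentwise_within], rule ballI)
      fix e :: "real ^ 'n" assume "e \<in> Basis"
      then obtain i where "e = axis i 1" by (auto simp: Basis_vec_def)
      then show "((\<lambda>x. \<xi> x \<bullet> e) has_derivative (\<lambda>h. (h *\<^sub>R (\<chi> i. q i)) \<bullet> e)) (at x)"
        using q[of i] by (simp add: inner_axis has_field_derivative_def mult.commute[of _ "q i"])
    qed
    then show "\<exists>q. (\<xi> has_vector_derivative q) (at x)" by (auto simp: has_vector_derivative_def)
  qed
qed

text \<open>The averages in \<open>integrable_ccontinuous_explicit\<close> are taken to the right of
  the point. Applying it also to the reflected function gives the averages to the left, and the two
  one-sided statements combine into a derivative.\<close>

lemma AE_has_derivative_indefinite_integral:
  fixes f :: "real \<Rightarrow> real"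
  assumes f: "f integrable_on {a..b}"
  obtains N where "negligible N" "\<And>x. x \<in> {a<..<b} - N \<Longrightarrow>
    ((\<lambda>x. integral {a..x} f) has_real_derivative f x) (at x)"
proof -
  \<comment> \<open>Extension by zero makes the function integrable over every interval, as the
    averaging theorem demands.\<close>
  define F where "F x = (if x \<in> {a..b} then f x else 0)" for x
  have F: "F integrable_on {c..d}" for c d
  proof -
    have "F integrable_on UNIV" unfolding F_def using f integrable_restrict_UNIV by blast
    then show ?thesis by (metis integrable_on_subcbox subset_UNIV cbox_interval)
  qed
  have F': "(\<lambda>x. F (- x)) integrable_on {c..d}" for c d
    using F[of "- d" "- c"] Henstock_Kurzweil_Integration.integrable_reflect_real[where f = F and a = "- d" and b = "- c"] by simp
  obtain N1 where N1: "negligible N1" "\<And>x e. x \<notin> N1 \<Longrightarrow> 0 < e \<Longrightarrow>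
      \<exists>d>0. \<forall>h. 0 < h \<and> h < d \<longrightarrow> \<bar>integral {x..x + h} F / h - F x\<bar> < e"
    using integrable_ccontinuous_explicit[of F] F by (auto simp: cbox_interval divide_inverse mult.commute)
  obtain N2 where N2: "negligible N2" "\<And>x e. x \<notin> N2 \<Longrightarrow> 0 < e \<Longrightarrow>
      \<exists>d>0. \<forall>h. 0 < h \<and> h < d \<longrightarrow> \<bar>integral {x..x + h} (\<lambda>x. F (- x)) / h - F (- x)\<bar> < e"
    using integrable_ccontinuous_explicit[of "\<lambda>x. F (- x)"] F'
    by (auto simp: cbox_interval divide_inverse mult.commute)
  show ?thesis
  proof
    show "negligible (N1 \<union> uminus ` N2)"
      using N1(1) N2(1) by (intro negligible_Un negligible_differentiable_image_negligible)
        (auto intro!: derivative_intros simp: differentiable_on_def)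
    fix x assume x: "x \<in> {a<..<b} - (N1 \<union> uminus ` N2)"
    then have x1: "x \<notin> N1" and x2: "- x \<notin> N2" by (auto simp: image_iff)
    show "((\<lambda>x. integral {a..x} f) has_real_derivative f x) (at x)"
      unfolding has_field_derivative_def has_derivative_at_alt
    proof (intro conjI allI impI)
      show "bounded_linear ((*) (f x))" by (rule bounded_linear_mult_right)
      fix e :: real assume e: "e > 0"
      obtain d1 where d1: "d1 > 0" "\<And>h. 0 < h \<Longrightarrow> h < d1 \<Longrightarrow> \<bar>integral {x..x + h} F / h - F x\<bar> < e"
        using N1(2)[OF x1 e] by blast
      obtain d2 where d2: "d2 > 0"
        "\<And>h. 0 < h \<Longrightarrow> h < d2 \<Longrightarrow> \<bar>integral {- x..- x + h} (\<lambda>x. F (- x)) / h - F x\<bar> < e"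
        using N2(2)[OF x2 e] by auto
      define d where "d = min (min d1 d2) (min (x - a) (b - x))"
      have d: "d > 0" "d \<le> d1" "d \<le> d2" "d \<le> x - a" "d \<le> b - x" using d1 d2 x by (auto simp: d_def)
      have Fx: "F x = f x" using x by (simp add: F_def)
      have Ff: "integral {c..d} F = integral {c..d} f" if "a \<le> c" "d \<le> b" for c d
        using that by (intro integral_cong) (auto simp: F_def)
      have comb: "integral {a..z} f = integral {a..y} f + integral {y..z} f"
        if "a \<le> y" "y \<le> z" "z \<le> b" for y z
        using that f by (intro Henstock_Kurzweil_Integration.integral_combine[symmetric])
          (auto intro: integrable_on_subinterval)
      show "\<exists>d>0. \<forall>y. norm (y - x) < d \<longrightarrow>
        norm (integral {a..y} f - integral {a..x} f - f x * (y - x)) \<le> e * norm (y - x)"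
      proof (intro exI conjI allI impI)
        fix y assume y: "norm (y - x) < d"
        have key: "\<bar>I - f x * h\<bar> \<le> e * h" if "h > 0" "\<bar>I / h - f x\<bar> < e" for I h
        proof -
          have "I - f x * h = (I / h - f x) * h" using that(1) by (simp add: field_simps)
          then have "\<bar>I - f x * h\<bar> = \<bar>I / h - f x\<bar> * h" using that(1) by (simp add: abs_mult)
          then show ?thesis using that by (simp add: mult_right_mono)
        qed
        consider "y < x" | "y = x" | "x < y" by linarith
        then show "norm (integral {a..y} f - integral {a..x} f - f x * (y - x)) \<le> e * norm (y - x)"
        proof cases
          case 1
          have "integral {- x..- x + (x - y)} (\<lambda>x. F (- x)) = integral {y..x} f"
            using Ff[of y x] 1 y d x Henstock_Kurzweil_Integration.integral_reflect_real[of x y F] by simp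
          then have "\<bar>integral {y..x} f / (x - y) - f x\<bar> < e"
            using d2(2)[of "x - y"] 1 y d Fx by auto
          from key[OF _ this] have "\<bar>integral {y..x} f - f x * (x - y)\<bar> \<le> e * (x - y)" using 1 by simp
          moreover have "integral {a..x} f = integral {a..y} f + integral {y..x} f"
            using 1 y d x by (intro comb) auto
          ultimately show ?thesis using 1 by (simp add: abs_le_iff algebra_simps)
        next
          case 3
          have "integral {x..x + (y - x)} F = integral {x..y} f"
            using Ff[of x y] 3 y d x by simp
          then have "\<bar>integral {x..y} f / (y - x) - f x\<bar> < e"
            using d1(2)[of "y - x"] 3 y d Fx by auto
          from key[OF _ this] have "\<bar>integral {x..y} f - f x * (y - x)\<bar> \<le> e * (y - x)" using 3 by simp
          moreover have "integral {a..y} f = integral {a..x} f + integral {x..y} f"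
            using 3 y d x by (intro comb) auto
          ultimately show ?thesis using 3 by simp
        qed simp
      qed (rule d)
    qed
  qed
qed

section \<open>The torus\<close>

lemma torus_of_surj: "\<exists>y. torus_of y = x"
  by (transfer, rule_tac x = x in exI) simp

lemma torus_shift_torus_of: "torus_shift (torus_of y) z = torus_of (y + z)"
  by transfer auto

lemma continuous_on_torus_of: "continuous_on S torus_of"
  by (rule continuous_on_subset[of UNIV]) (auto simp: continuous_on_open_vimage open_torus_def)

lemma torus_of_unit_cube: "\<exists>y \<in> cbox 0 1. torus_of y = x"
proof -
  obtain y where y: "torus_of y = x" using torus_of_surj by blast
  have "(\<chi> i. frac (y $ i)) \<in> cbox 0 1"
    by (auto simp: mem_box_cart frac_lt_1 less_imp_le)
  moreover have "torus_of (\<chi> i. frac (y $ i)) = torus_of y"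
    by (auto simp: torus_of_eq_iff frac_def)
  ultimately show ?thesis using y by auto
qed

lemma compact_torus: "compact (UNIV :: ('n::finite) torus set)"
proof -
  have "compact (torus_of ` cbox 0 1 :: 'n torus set)"
    by (intro compact_continuous_image continuous_on_torus_of compact_cbox)
  moreover have "torus_of ` cbox 0 1 = (UNIV :: 'n torus set)"
    by (metis UNIV_eq_I image_eqI torus_of_unit_cube)
  ultimately show ?thesis by simp
qed

text \<open>Distinct points differ modulo 1 in some coordinate i, and w \<mapsto> exp(2 pi i w_i)
  descends to a continuous function on the torus that separates them. The Hausdorff property is what
  makes the compact graph of a curve closed, hence Borel.\<close>

instance torus :: (finite) t2_space
proof
  fix x y :: "'a torus" assume "x \<noteq> y"
  obtain u v where u: "torus_of u = x" and v: "torus_of v = y" using torus_of_surj by metis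
  then obtain i where i: "u $ i - v $ i \<notin> \<int>" using \<open>x \<noteq> y\<close> by (auto simp: torus_of_eq_iff)
  define ch where "ch w = cis (2 * pi * (w $ i))" for w :: "real ^ 'a"
  \<comment> \<open>The value at an arbitrarily chosen representative; by periodicity of
    \<open>ch\<close> the choice does not matter.\<close>
  define c where "c z = ch (SOME w. torus_of w = z)" for z
  have c: "c (torus_of w) = ch w" for w
  proof -
    have "torus_of (SOME w'. torus_of w' = torus_of w) = torus_of w" by (rule someI) simp
    then have "(SOME w'. torus_of w' = torus_of w) $ i - w $ i \<in> \<int>" by (simp add: torus_of_eq_iff)
    then obtain n where "(SOME w'. torus_of w' = torus_of w) $ i = w $ i + of_int n"
      by (auto elim!: Ints_cases simp: algebra_simps)
    then show ?thesis
      by (simp add: c_def ch_def distrib_left cis_mult[symmetric] cis_multiple_2pi)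
  qed
  have "ch u \<noteq> ch v"
  proof
    assume "ch u = ch v"
    then have "cis (2 * pi * (u $ i - v $ i)) = 1"
      by (simp add: ch_def right_diff_distrib cis_divide[symmetric])
    then have "cos (2 * pi * (u $ i - v $ i)) = 1" by (metis cis.sel(1) one_complex.sel(1))
    then show False using i by (auto simp: cos_one_2pi_int)
  qed
  then obtain A B where AB: "open A" "open B" "ch u \<in> A" "ch v \<in> B" "A \<inter> B = {}"
    using hausdorff by metis
  have "continuous_on UNIV ch" unfolding ch_def by (intro continuous_intros)
  then have op: "open (ch -` S)" if "open S" for S using that by (simp add: continuous_on_open_vimage)
  have "torus_of -` (c -` S) = ch -` S" for S by (auto simp: c)
  then have "open (c -` S)" if "open S" for S using op[OF that] by (simp add: open_torus_def)
  then show "\<exists>U V. open U \<and> open V \<and> x \<in> U \<and> y \<in> V \<and> U \<inter> V = {}"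
    using AB u v c by (intro exI[of _ "c -` A"] exI[of _ "c -` B"]) auto
qed

lemma torus_abs_cont_on_continuous:
  assumes "torus_abs_cont_on a b \<zeta>"
  shows "continuous_on {a..b} \<zeta>"
proof -
  obtain \<xi> where \<xi>: "abs_cont_on a b \<xi>" "\<And>s. s \<in> {a..b} \<Longrightarrow> \<zeta> s = torus_of (\<xi> s)"
    using assms unfolding torus_abs_cont_on_def by blast
  have "continuous_on {a..b} (torus_of \<circ> \<xi>)"
    by (intro continuous_on_compose abs_cont_on_continuous \<xi> continuous_on_torus_of)
  then show ?thesis by (rule continuous_on_eq) (use \<xi>(2) in auto)
qed

section \<open>The Lagrangian\<close>

locale superlinear_hamiltonian =
  fixes H :: "('n::finite) torus \<Rightarrow> real \<Rightarrow> real ^ 'n \<Rightarrow> real" and T :: real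
  assumes H_cont: "continuous_on (UNIV \<times> {0..T} \<times> UNIV) (\<lambda>(x, t, p). H x t p)"
    and H_superlinear: "superlinear_on T H"
begin

text \<open>The torus carries a topology but no metric here, so the uniform continuity arguments for
  the Lagrangian are carried out on the covering space.\<close>

lemma H_lift_continuous: "continuous_on (UNIV \<times> {0..T} \<times> UNIV) (\<lambda>(y, t, p). H (torus_of y) t p)"
proof -
  have "continuous_on (UNIV \<times> {0..T} \<times> UNIV)
      ((\<lambda>(x, t, p). H x t p) \<circ> (\<lambda>z. (torus_of (fst z), snd z)))"
    by (intro continuous_on_compose continuous_intros continuous_on_compose2[OF continuous_on_torus_of]
        continuous_on_subset[OF H_cont]) auto
  then show ?thesis by (simp add: case_prod_unfold comp_def)
qed

lemma H_bounded: "\<exists>C\<ge>0. \<forall>x. \<forall>t\<in>{0..T}. \<forall>p. norm p \<le> R \<longrightarrow> \<bar>H x t p\<bar> \<le> C"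
proof -
  have "compact ((\<lambda>(y, t, p). H (torus_of y) t p) ` (cbox 0 1 \<times> {0..T} \<times> cball 0 R))"
    by (intro compact_continuous_image continuous_on_subset[OF H_lift_continuous] compact_Times) auto
  then obtain C where C: "\<And>z. z \<in> cbox 0 1 \<times> {0..T} \<times> cball 0 R \<Longrightarrow>
      norm ((\<lambda>(y, t, p). H (torus_of y) t p) z) \<le> C"
    using compact_imp_bounded bounded_iff by (metis imageI)
  have "\<bar>H x t p\<bar> \<le> max C 0" if t: "t \<in> {0..T}" and p: "norm p \<le> R" for x t p
  proof -
    obtain y where "y \<in> cbox 0 1" "torus_of y = x" using torus_of_unit_cube by blast
    then show ?thesis using C[of "(y, t, p)"] t p by (auto simp: max_def)
  qed
  then show ?thesis by (intro exI[of _ "max C 0"]) auto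
qed

text \<open>For velocities of norm at most \<open>R\<close> the supremum defining the Lagrangian may be restricted to
  a fixed ball of momenta.\<close>

lemma momentum_ball:
  "\<exists>P>0. \<forall>x. \<forall>t\<in>{0..T}. \<forall>q p. norm q \<le> R \<longrightarrow> P < norm p \<longrightarrow> inner p q - H x t p \<le> - H x t 0"
proof -
  obtain C where C: "C \<ge> 0" "\<And>x t. t \<in> {0..T} \<Longrightarrow> \<bar>H x t 0\<bar> \<le> C"
    using H_bounded[of 0] by auto
  \<comment> \<open>The part |R| absorbs the inner product with q, and C |p| dominates H(x, t, 0)
    once |p| is at least 1, which explains the radius \<open>max b 1\<close>.\<close>
  define K where "K = \<bar>R\<bar> + C"
  have "\<forall>\<^sub>F p in at_infinity. \<forall>x. \<forall>t\<in>{0..T}. K \<le> H x t p / norm p"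
    using H_superlinear by (simp add: superlinear_on_def)
  then obtain b where b: "\<And>p x t. b \<le> norm p \<Longrightarrow> t \<in> {0..T} \<Longrightarrow> K \<le> H x t p / norm p"
    unfolding eventually_at_infinity by blast
  have "inner p q - H x t p \<le> - H x t 0"
    if t: "t \<in> {0..T}" and q: "norm q \<le> R" and p: "max b 1 < norm p" for x t q p
  proof -
    have "K \<le> H x t p / norm p" using b[of p t x] p t by simp
    moreover have "norm p > 0" using p by linarith
    ultimately have H: "K * norm p \<le> H x t p" by (simp only: pos_le_divide_eq)
    have "inner p q \<le> norm p * norm q" by (rule norm_cauchy_schwarz)
    also have "\<dots> \<le> norm p * \<bar>R\<bar>" using q by (intro mult_left_mono) auto
    finally have "inner p q - H x t p \<le> - (C * norm p)" using H by (simp add: K_def algebra_simps)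
    also have "\<dots> \<le> - C" using p mult_left_mono[of 1 "norm p" C] C(1) by simp
    finally show ?thesis using C(2)[OF t, of x] by linarith
  qed
  then show ?thesis by (intro exI[of _ "max b 1"]) auto
qed

lemma bdd_above_legendre:
  assumes t: "t \<in> {0..T}"
  shows "bdd_above (range (\<lambda>p. inner p q - H x t p))"
proof -
  obtain P where P: "P > 0" "\<And>p. P < norm p \<Longrightarrow> inner p q - H x t p \<le> - H x t 0"
    using momentum_ball[of "norm q"] t by blast
  obtain C where C: "C \<ge> 0" "\<And>p. norm p \<le> P \<Longrightarrow> \<bar>H x t p\<bar> \<le> C"
    using H_bounded[of P] t by blast
  have "inner p q - H x t p \<le> P * norm q + C" for p
  proof (cases "norm p \<le> P")
    case True
    have "inner p q \<le> norm p * norm q" by (rule norm_cauchy_schwarz)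
    also have "\<dots> \<le> P * norm q" using True by (intro mult_right_mono) auto
    finally show ?thesis using C(2)[OF True] by linarith
  next
    case False
    then have "inner p q - H x t p \<le> - H x t 0" using P(2) by simp
    also have "\<dots> \<le> C" using C(2)[of 0] P(1) by simp
    also have "\<dots> \<le> P * norm q + C" using P(1) by simp
    finally show ?thesis .
  qed
  then show ?thesis by (intro bdd_aboveI2)
qed

lemma legendre_le_lagrangian: "t \<in> {0..T} \<Longrightarrow> inner p q - H x t p \<le> lagrangian H x t q"
  unfolding lagrangian_def by (intro cSUP_upper bdd_above_legendre) auto

lemma lagrangian_bounded_below: "\<exists>C\<ge>0. \<forall>x. \<forall>t\<in>{0..T}. \<forall>q. - C \<le> lagrangian H x t q"
proof -
  obtain C where C: "C \<ge> 0" "\<And>x t. t \<in> {0..T} \<Longrightarrow> \<bar>H x t 0\<bar> \<le> C"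
    using H_bounded[of 0] by auto
  have "- C \<le> lagrangian H x t q" if "t \<in> {0..T}" for x t q
    using legendre_le_lagrangian[OF that, of 0 q x] C(2)[OF that, of x] by simp
  then show ?thesis using C(1) by blast
qed

text \<open>By \<open>momentum_ball\<close> the supremum is effectively over one compact ball for
  all velocities near q0. There the competing expressions are uniformly continuous in the
  parameters, uniformly in p, and so are their suprema.\<close>

lemma lagrangian_continuous:
  "continuous_on (UNIV \<times> {0..T} \<times> UNIV) (\<lambda>(y, t, q). lagrangian H (torus_of y) t q)"
  unfolding continuous_on_iff
proof (intro ballI allI impI)
  fix z0 :: "(real ^ 'n) \<times> real \<times> (real ^ 'n)" and \<epsilon> :: real
  assume z0: "z0 \<in> UNIV \<times> {0..T} \<times> UNIV" and \<epsilon>: "\<epsilon> > 0"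
  obtain y0 t0 q0 where z0_eq: "z0 = (y0, t0, q0)" by (cases z0)
  define K where "K = cball y0 1 \<times> {0..T} \<times> cball q0 1"
  obtain P where P: "P > 0"
    "\<And>x t q p. t \<in> {0..T} \<Longrightarrow> norm q \<le> norm q0 + 1 \<Longrightarrow> P < norm p \<Longrightarrow> inner p q - H x t p \<le> - H x t 0"
    using momentum_ball[of "norm q0 + 1"] by blast
  define \<phi> where "\<phi> = (\<lambda>(z :: (real ^ 'n) \<times> real \<times> (real ^ 'n), p).
    inner p (snd (snd z)) - H (torus_of (fst z)) (fst (snd z)) p)"
  have "continuous_on (K \<times> cball 0 P)
      ((\<lambda>(y, t, p). H (torus_of y) t p) \<circ> (\<lambda>w. (fst (fst w), fst (snd (fst w)), snd w)))"
    by (intro continuous_on_compose continuous_intros continuous_on_subset[OF H_lift_continuous])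
      (auto simp: K_def)
  then have "continuous_on (K \<times> cball 0 P) \<phi>"
    unfolding \<phi>_def case_prod_unfold comp_def by (intro continuous_intros) simp
  moreover have "compact (K \<times> cball (0 :: real ^ 'n) P)"
    unfolding K_def by (intro compact_Times) auto
  ultimately have "uniformly_continuous_on (K \<times> cball 0 P) \<phi>"
    by (rule compact_uniformly_continuous)
  then obtain d where d: "d > 0" "\<And>w w'. w \<in> K \<times> cball 0 P \<Longrightarrow> w' \<in> K \<times> cball 0 P \<Longrightarrow>
      dist w' w < d \<Longrightarrow> dist (\<phi> w') (\<phi> w) < \<epsilon> / 2"
    unfolding uniformly_continuous_on_def using \<epsilon> by (meson half_gt_zero)
  have le: "lagrangian H (torus_of y) t q \<le> lagrangian H (torus_of y') t' q' + \<epsilon> / 2"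
    if z: "(y, t, q) \<in> K" and z': "(y', t', q') \<in> K" and dz: "dist (y, t, q) (y', t', q') < d"
    for y t q y' t' q'
  proof -
    have q: "norm q \<le> norm q0 + 1"
      using z norm_triangle_ineq2[of q q0] by (auto simp: K_def dist_norm norm_minus_commute)
    have t: "t \<in> {0..T}" "t' \<in> {0..T}" using z z' by (auto simp: K_def)
    have inside: "inner p q - H (torus_of y) t p \<le> lagrangian H (torus_of y') t' q' + \<epsilon> / 2"
      if p: "norm p \<le> P" for p
    proof -
      have "dist ((y, t, q), p) ((y', t', q'), p) < d"
        using dz by (simp add: dist_Pair_Pair)
      then have "\<bar>\<phi> ((y, t, q), p) - \<phi> ((y', t', q'), p)\<bar> < \<epsilon> / 2"
        using d(2)[of "((y', t', q'), p)" "((y, t, q), p)"] z z' p by (simp add: dist_real_def)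
      then have "\<bar>(inner p q - H (torus_of y) t p) - (inner p q' - H (torus_of y') t' p)\<bar> < \<epsilon> / 2"
        by (simp add: \<phi>_def)
      then show ?thesis
        using legendre_le_lagrangian[OF t(2), of p q' "torus_of y'"] by linarith
    qed
    show ?thesis
      unfolding lagrangian_def[of H "torus_of y"]
    proof (rule cSUP_least)
      fix p
      show "inner p q - H (torus_of y) t p \<le> lagrangian H (torus_of y') t' q' + \<epsilon> / 2"
      proof (cases "norm p \<le> P")
        \<comment> \<open>A momentum outside the ball does no better than p = 0, which lies inside
          it.\<close>
        case False
        then have "inner p q - H (torus_of y) t p \<le> inner 0 q - H (torus_of y) t 0"
          using P(2)[OF t(1) q] by simp
        also have "\<dots> \<le> lagrangian H (torus_of y') t' q' + \<epsilon> / 2"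
          using P(1) by (intro inside) simp
        finally show ?thesis .
      qed (rule inside)
    qed simp
  qed
  show "\<exists>d>0. \<forall>z\<in>UNIV \<times> {0..T} \<times> UNIV. dist z z0 < d \<longrightarrow>
    dist (case z of (y, t, q) \<Rightarrow> lagrangian H (torus_of y) t q)
      (case z0 of (y, t, q) \<Rightarrow> lagrangian H (torus_of y) t q) < \<epsilon>"
  proof (intro exI conjI ballI impI)
    show "min d 1 > 0" using d by simp
    fix z :: "(real ^ 'n) \<times> real \<times> (real ^ 'n)"
    assume z: "z \<in> UNIV \<times> {0..T} \<times> UNIV" and dz: "dist z z0 < min d 1"
    obtain y t q where z_eq: "z = (y, t, q)" by (cases z)
    have z0K: "(y0, t0, q0) \<in> K" using z0 by (auto simp: K_def z0_eq)
    have "dist y y0 \<le> dist z z0" "dist q q0 \<le> dist z z0"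
      unfolding z_eq z0_eq using dist_fst_le[of "(y, t, q)" "(y0, t0, q0)"]
        dist_snd_le[of "(y, t, q)" "(y0, t0, q0)"] dist_snd_le[of "(t, q)" "(t0, q0)"] by auto
    then have zK: "(y, t, q) \<in> K" using z dz by (auto simp: K_def z_eq dist_commute)
    show "dist (case z of (y, t, q) \<Rightarrow> lagrangian H (torus_of y) t q)
      (case z0 of (y, t, q) \<Rightarrow> lagrangian H (torus_of y) t q) < \<epsilon>"
      using le[OF zK z0K] le[OF z0K zK] dz \<epsilon>
      by (auto simp: z_eq z0_eq dist_real_def dist_commute)
  qed
qed

text \<open>The upper half of continuity, in the form that bounds the cost of short segments. The
  separate distances d / 3 add up to less than d in the product metric.\<close>

lemma lagrangian_locally_le:
  assumes t: "t \<in> {0..T}" and \<epsilon>: "\<epsilon> > 0"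
  shows "\<exists>d>0. \<forall>y s w. s \<in> {0..T} \<longrightarrow> norm (y - y0) < d \<longrightarrow> \<bar>s - t\<bar> < d \<longrightarrow> norm (w - q) < d \<longrightarrow>
    lagrangian H (torus_of y) s w \<le> lagrangian H (torus_of y0) t q + \<epsilon>"
proof -
  have "(y0, t, q) \<in> UNIV \<times> {0..T} \<times> UNIV" using t by simp
  then obtain d where d: "d > 0" "\<And>z. z \<in> UNIV \<times> {0..T} \<times> UNIV \<Longrightarrow> dist z (y0, t, q) < d \<Longrightarrow>
      dist (case z of (y, t, q) \<Rightarrow> lagrangian H (torus_of y) t q) (lagrangian H (torus_of y0) t q) < \<epsilon>"
    using lagrangian_continuous \<epsilon> unfolding continuous_on_iff by fastforce
  have "lagrangian H (torus_of y) s w \<le> lagrangian H (torus_of y0) t q + \<epsilon>"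
    if "s \<in> {0..T}" "norm (y - y0) < d / 3" "\<bar>s - t\<bar> < d / 3" "norm (w - q) < d / 3" for y s w
  proof -
    have "dist (y, s, w) (y0, t, q) \<le> dist y y0 + dist (s, w) (t, q)"
      unfolding dist_Pair_Pair[of y] by (rule sqrt_sum_squares_le_sum) auto
    also have "dist (s, w) (t, q) \<le> dist s t + dist w q"
      unfolding dist_Pair_Pair by (rule sqrt_sum_squares_le_sum) auto
    finally have "dist (y, s, w) (y0, t, q) < d"
      using that by (simp add: dist_norm)
    from d(2)[OF _ this] show ?thesis using that(1) by (auto simp: dist_real_def)
  qed
  then show ?thesis using d(1) by (intro exI[of _ "d / 3"]) auto
qed

end

section \<open>Joining curves\<close>

lemma has_torus_velocity_local:
  assumes "has_torus_velocity \<zeta> q t" and ev: "\<forall>\<^sub>F s in nhds t. \<zeta> s = \<eta> s"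
  shows "has_torus_velocity \<eta> q t"
proof -
  obtain \<xi> where \<xi>: "\<And>s. \<zeta> s = torus_of (\<xi> s)" "(\<xi> has_vector_derivative q) (at t)"
    using assms(1) unfolding has_torus_velocity_def by blast
  \<comment> \<open>A lift has to be given at all times, so wherever the two curves disagree an
    arbitrary representative is chosen; near t this does not happen.\<close>
  define \<xi>' where "\<xi>' s = (if \<zeta> s = \<eta> s then \<xi> s else (SOME y. torus_of y = \<eta> s))" for s
  have "torus_of (\<xi>' s) = \<eta> s" for s
    using \<xi>(1)[of s] someI_ex[OF torus_of_surj[of "\<eta> s"]] by (auto simp: \<xi>'_def)
  moreover have "(\<xi>' has_vector_derivative q) (at t)"
    using \<xi>(2) unfolding has_vector_derivative_def
  proof (rule has_derivative_transform_eventually)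
    show "\<forall>\<^sub>F s in at t. \<xi> s = \<xi>' s"
      using ev by (auto simp: eventually_at_filter \<xi>'_def elim: eventually_mono)
    show "\<xi> t = \<xi>' t" using eventually_nhds_x_imp_x[OF ev] by (simp add: \<xi>'_def)
  qed simp
  ultimately show ?thesis unfolding has_torus_velocity_def by metis
qed

lemma torus_velocity_local:
  assumes "\<forall>\<^sub>F s in nhds t. \<zeta> s = \<eta> s"
  shows "torus_velocity \<zeta> t = torus_velocity \<eta> t"
proof -
  have "\<forall>\<^sub>F s in nhds t. \<eta> s = \<zeta> s" using assms by (simp add: eq_commute)
  then have "has_torus_velocity \<zeta> q t \<longleftrightarrow> has_torus_velocity \<eta> q t" for q
    using has_torus_velocity_local assms by metis
  then show ?thesis by (simp add: torus_velocity_def)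
qed

lemma torus_velocity_lift:
  assumes lift: "\<And>s. s \<in> {a..b} \<Longrightarrow> \<zeta> s = torus_of (\<xi> s)" and t: "t \<in> {a<..<b}"
    and \<xi>: "(\<xi> has_vector_derivative q) (at t)"
  shows "torus_velocity \<zeta> t = q"
proof (rule torus_velocity_eqI, rule has_torus_velocity_local)
  show "has_torus_velocity (\<lambda>s. torus_of (\<xi> s)) q t"
    using \<xi> unfolding has_torus_velocity_def by blast
  have "\<forall>\<^sub>F s in nhds t. s \<in> {a<..<b}" using t by (intro eventually_nhds_in_open) auto
  then show "\<forall>\<^sub>F s in nhds t. torus_of (\<xi> s) = \<zeta> s"
    by eventually_elim (use lift in auto)
qed

section \<open>Stability of absolute continuity under sums, reparametrisation and gluing\<close>

lemma abs_cont_onI: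
  assumes "\<And>\<epsilon>. \<epsilon> > 0 \<Longrightarrow> \<exists>\<delta>>0. \<forall>d. d division_of \<Union>d \<longrightarrow> \<Union>d \<subseteq> {a..b} \<longrightarrow>
      (\<Sum>k\<in>d. Sup k - Inf k) < \<delta> \<longrightarrow> (\<Sum>k\<in>d. norm (\<xi> (Sup k) - \<xi> (Inf k))) < \<epsilon>"
  shows "abs_cont_on a b \<xi>"
  unfolding abs_cont_on_def
proof (intro allI impI)
  fix \<epsilon> :: real assume "\<epsilon> > 0"
  from assms[OF this] obtain \<delta> where "\<delta> > 0" and \<delta>: "\<forall>d. d division_of \<Union>d \<longrightarrow> \<Union>d \<subseteq> {a..b} \<longrightarrow>
      (\<Sum>k\<in>d. Sup k - Inf k) < \<delta> \<longrightarrow> (\<Sum>k\<in>d. norm (\<xi> (Sup k) - \<xi> (Inf k))) < \<epsilon>"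
    by (elim exE conjE) (rule that)
  show "\<exists>\<delta>>0. \<forall>d S. d division_of S \<and> S \<subseteq> {a..b} \<and> (\<Sum>k\<in>d. Sup k - Inf k) < \<delta> \<longrightarrow>
    (\<Sum>k\<in>d. norm (\<xi> (Sup k) - \<xi> (Inf k))) < \<epsilon>"
  proof (intro exI conjI allI impI)
    fix d and S :: "real set"
    assume d: "d division_of S \<and> S \<subseteq> {a..b} \<and> (\<Sum>k\<in>d. Sup k - Inf k) < \<delta>"
    then have "S = \<Union>d" by (simp add: division_of_def)
    then show "(\<Sum>k\<in>d. norm (\<xi> (Sup k) - \<xi> (Inf k))) < \<epsilon>" using d \<delta> by blast
  qed fact
qed

lemma abs_cont_on_add:
  assumes "abs_cont_on a b \<xi>" "abs_cont_on a b \<eta>"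
  shows "abs_cont_on a b (\<lambda>s. \<xi> s + \<eta> s)"
proof (rule abs_cont_onI)
  fix \<epsilon> :: real assume \<epsilon>: "\<epsilon> > 0"
  obtain \<delta>1 where \<delta>1: "\<delta>1 > 0" "\<forall>d. d division_of \<Union>d \<longrightarrow> \<Union>d \<subseteq> {a..b} \<longrightarrow>
      (\<Sum>k\<in>d. Sup k - Inf k) < \<delta>1 \<longrightarrow> (\<Sum>k\<in>d. norm (\<xi> (Sup k) - \<xi> (Inf k))) < \<epsilon> / 2"
    using abs_cont_onD[OF assms(1), of "\<epsilon> / 2"] \<epsilon> by auto
  obtain \<delta>2 where \<delta>2: "\<delta>2 > 0" "\<forall>d. d division_of \<Union>d \<longrightarrow> \<Union>d \<subseteq> {a..b} \<longrightarrow>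
      (\<Sum>k\<in>d. Sup k - Inf k) < \<delta>2 \<longrightarrow> (\<Sum>k\<in>d. norm (\<eta> (Sup k) - \<eta> (Inf k))) < \<epsilon> / 2"
    using abs_cont_onD[OF assms(2), of "\<epsilon> / 2"] \<epsilon> by auto
  show "\<exists>\<delta>>0. \<forall>d. d division_of \<Union>d \<longrightarrow> \<Union>d \<subseteq> {a..b} \<longrightarrow> (\<Sum>k\<in>d. Sup k - Inf k) < \<delta> \<longrightarrow>
    (\<Sum>k\<in>d. norm (\<xi> (Sup k) + \<eta> (Sup k) - (\<xi> (Inf k) + \<eta> (Inf k)))) < \<epsilon>"
  proof (intro exI conjI allI impI)
    show "min \<delta>1 \<delta>2 > 0" using \<delta>1 \<delta>2 by simp
    fix d :: "real set set"
    assume d: "d division_of \<Union>d" "\<Union>d \<subseteq> {a..b}" "(\<Sum>k\<in>d. Sup k - Inf k) < min \<delta>1 \<delta>2"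
    have "(\<Sum>k\<in>d. norm (\<xi> (Sup k) + \<eta> (Sup k) - (\<xi> (Inf k) + \<eta> (Inf k)))) \<le>
        (\<Sum>k\<in>d. norm (\<xi> (Sup k) - \<xi> (Inf k)) + norm (\<eta> (Sup k) - \<eta> (Inf k)))"
      by (intro sum_mono) (metis add_diff_add norm_triangle_ineq)
    also have "\<dots> < \<epsilon>"
      using \<delta>1(2)[rule_format, OF d(1,2)] \<delta>2(2)[rule_format, OF d(1,2)] d(3) by (simp add: sum.distrib)
    finally show "(\<Sum>k\<in>d. norm (\<xi> (Sup k) + \<eta> (Sup k) - (\<xi> (Inf k) + \<eta> (Inf k)))) < \<epsilon>" .
  qed
qed

lemma abs_cont_on_Lipschitz:
  assumes lip: "\<And>s t. s \<in> {a..b} \<Longrightarrow> t \<in> {a..b} \<Longrightarrow> norm (\<xi> t - \<xi> s) \<le> M * \<bar>t - s\<bar>"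
  shows "abs_cont_on a b \<xi>"
proof (rule abs_cont_onI)
  fix \<epsilon> :: real assume \<epsilon>: "\<epsilon> > 0"
  show "\<exists>\<delta>>0. \<forall>d. d division_of \<Union>d \<longrightarrow> \<Union>d \<subseteq> {a..b} \<longrightarrow> (\<Sum>k\<in>d. Sup k - Inf k) < \<delta> \<longrightarrow>
    (\<Sum>k\<in>d. norm (\<xi> (Sup k) - \<xi> (Inf k))) < \<epsilon>"
  proof (intro exI conjI allI impI)
    show "\<epsilon> / (\<bar>M\<bar> + 1) > 0" using \<epsilon> by simp
    fix d :: "real set set"
    assume d: "d division_of \<Union>d" "\<Union>d \<subseteq> {a..b}" "(\<Sum>k\<in>d. Sup k - Inf k) < \<epsilon> / (\<bar>M\<bar> + 1)"
    have "(\<Sum>k\<in>d. norm (\<xi> (Sup k) - \<xi> (Inf k))) \<le> (\<Sum>k\<in>d. (\<bar>M\<bar> + 1) * (Sup k - Inf k))"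
    proof (intro sum_mono)
      fix k assume k: "k \<in> d"
      obtain u v where uv: "k = {u..v}" "u \<le> v"
        using division_ofD(3,4)[OF d(1) k] by (force simp: cbox_interval)
      then have "{u..v} \<subseteq> {a..b}" using d(2) k by blast
      then have "norm (\<xi> v - \<xi> u) \<le> M * \<bar>v - u\<bar>" using uv by (intro lip) auto
      also have "\<dots> \<le> (\<bar>M\<bar> + 1) * (v - u)" using uv(2) by (simp add: mult_right_mono)
      finally show "norm (\<xi> (Sup k) - \<xi> (Inf k)) \<le> (\<bar>M\<bar> + 1) * (Sup k - Inf k)" using uv by simp
    qed
    also have "\<dots> < \<epsilon>"
      using d(3) unfolding sum_distrib_left[symmetric] by (simp add: pos_less_divide_eq mult.commute add_nonneg_pos)
    finally show "(\<Sum>k\<in>d. norm (\<xi> (Sup k) - \<xi> (Inf k))) < \<epsilon>" .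
  qed
qed

text \<open>A nondecreasing 1-Lipschitz map sends a division to a division of no larger total
  length. It is applied to inclusions and to the clamping maps \<open>min s c\<close> and
  \<open>max s c\<close>, which collapse whole intervals to a point.\<close>

lemma abs_cont_on_compose_mono:
  assumes ac: "abs_cont_on a' b' \<xi>"
    and \<phi>: "\<And>s t. a \<le> s \<Longrightarrow> s \<le> t \<Longrightarrow> t \<le> b \<Longrightarrow> \<phi> s \<le> \<phi> t \<and> \<phi> t - \<phi> s \<le> t - s"
      "\<And>s. s \<in> {a..b} \<Longrightarrow> \<phi> s \<in> {a'..b'}"
  shows "abs_cont_on a b (\<lambda>s. \<xi> (\<phi> s))"
proof (rule abs_cont_onI)
  fix \<epsilon> :: real assume \<epsilon>: "\<epsilon> > 0"
  obtain \<delta> where \<delta>: "\<delta> > 0" "\<forall>d. d division_of \<Union>d \<longrightarrow> \<Union>d \<subseteq> {a'..b'} \<longrightarrow>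
      (\<Sum>k\<in>d. Sup k - Inf k) < \<delta> \<longrightarrow> (\<Sum>k\<in>d. norm (\<xi> (Sup k) - \<xi> (Inf k))) < \<epsilon>"
    using abs_cont_onD[OF ac \<epsilon>] by auto
  show "\<exists>\<delta>>0. \<forall>d. d division_of \<Union>d \<longrightarrow> \<Union>d \<subseteq> {a..b} \<longrightarrow> (\<Sum>k\<in>d. Sup k - Inf k) < \<delta> \<longrightarrow>
    (\<Sum>k\<in>d. norm (\<xi> (\<phi> (Sup k)) - \<xi> (\<phi> (Inf k)))) < \<epsilon>"
  proof (intro exI conjI allI impI)
    fix d :: "real set set"
    assume d: "d division_of \<Union>d" "\<Union>d \<subseteq> {a..b}" "(\<Sum>k\<in>d. Sup k - Inf k) < \<delta>"
    define G where "G k = {\<phi> (Inf k)..\<phi> (Sup k)}" for k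
    have fin: "finite d" using d(1) by blast
    have k: "\<exists>u v. k = {u..v} \<and> a \<le> u \<and> u \<le> v \<and> v \<le> b \<and> G k = {\<phi> u..\<phi> v} \<and> \<phi> u \<le> \<phi> v \<and>
        \<phi> v - \<phi> u \<le> v - u \<and> a' \<le> \<phi> u \<and> \<phi> v \<le> b'" if k: "k \<in> d" for k
    proof -
      obtain u v where uv: "k = {u..v}" "u \<le> v"
        using division_ofD(3,4)[OF d(1) k] by (force simp: cbox_interval)
      then have "{u..v} \<subseteq> {a..b}" using d(2) k by blast
      then have "a \<le> u" "v \<le> b" using uv by auto
      then show ?thesis using uv \<phi>(1)[of u v] \<phi>(2)[of u] \<phi>(2)[of v]
        by (intro exI[of _ u] exI[of _ v]) (simp add: G_def)
    qed
    have disj: "interior (G k) \<inter> interior (G l) = {}" if kl: "k \<in> d" "l \<in> d" "k \<noteq> l" for k l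
    proof -
      obtain u v where uv: "k = {u..v}" "a \<le> u" "u \<le> v" "v \<le> b" "G k = {\<phi> u..\<phi> v}"
        using k[OF kl(1)] by blast
      obtain w z where wz: "l = {w..z}" "a \<le> w" "w \<le> z" "z \<le> b" "G l = {\<phi> w..\<phi> z}"
        using k[OF kl(2)] by blast
      have "{u<..<v} \<inter> {w<..<z} = {}"
        using division_ofD(5)[OF d(1) kl] by (simp add: uv(1) wz(1) interior_atLeastAtMost_real)
      then have "u = v \<or> w = z \<or> v \<le> w \<or> z \<le> u"
        using uv(3) wz(3) dense[of "max u w" "min v z"]
        by (auto simp: disjoint_iff max_def min_def not_le split: if_splits)
      then have "\<phi> u = \<phi> v \<or> \<phi> w = \<phi> z \<or> \<phi> v \<le> \<phi> w \<or> \<phi> z \<le> \<phi> u"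
        using \<phi>(1)[of v w] \<phi>(1)[of z u] uv wz by auto
      then show ?thesis by (auto simp: uv(5) wz(5) interior_atLeastAtMost_real)
    qed
    have div: "(G ` d) division_of \<Union>(G ` d)"
    proof (rule division_ofI)
      fix K assume "K \<in> G ` d"
      then obtain l where l: "l \<in> d" "K = G l" by blast
      show "K \<subseteq> \<Union>(G ` d)" using l by blast
      show "K \<noteq> {}" "\<exists>a b. K = cbox a b" using k[OF l(1)] l(2) by (auto simp: cbox_interval)
      fix K' assume "K' \<in> G ` d" "K \<noteq> K'"
      then show "interior K \<inter> interior K' = {}" using disj l by blast
    qed (use fin in auto)
    \<comment> \<open>Distinct cells can have the same image only if that image is a single point,
      and there h vanishes; hence the sum may be reindexed although G need not be injective.\<close>
    have sumG: "sum h (G ` d) = (\<Sum>k\<in>d. h (G k))"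
      if h: "\<And>s. h {s..s} = 0" for h :: "real set \<Rightarrow> real"
    proof (rule sum.reindex_nontrivial[OF fin, unfolded comp_def])
      fix K l assume kl: "K \<in> d" "l \<in> d" "K \<noteq> l" "G K = G l"
      then have "interior (G K) = {}" using disj[of K l] by simp
      moreover obtain u v where "G K = {u..v}" "u \<le> v" using k[OF kl(1)] by blast
      ultimately show "h (G K) = 0" using h[of u] by (simp add: interior_atLeastAtMost_real)
    qed
    have "(\<Sum>k\<in>G ` d. Sup k - Inf k) = (\<Sum>k\<in>d. Sup (G k) - Inf (G k))"
      by (rule sumG) simp
    also have "\<dots> \<le> (\<Sum>k\<in>d. Sup k - Inf k)"
      by (intro sum_mono) (use k in fastforce)
    finally have len: "(\<Sum>k\<in>G ` d. Sup k - Inf k) < \<delta>" using d(3) by simp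
    have "(\<Sum>k\<in>G ` d. norm (\<xi> (Sup k) - \<xi> (Inf k))) = (\<Sum>k\<in>d. norm (\<xi> (Sup (G k)) - \<xi> (Inf (G k))))"
      by (rule sumG) simp
    also have "\<dots> = (\<Sum>k\<in>d. norm (\<xi> (\<phi> (Sup k)) - \<xi> (\<phi> (Inf k))))"
      by (intro sum.cong refl) (use k in fastforce)
    finally have eq: "(\<Sum>k\<in>G ` d. norm (\<xi> (Sup k) - \<xi> (Inf k))) =
      (\<Sum>k\<in>d. norm (\<xi> (\<phi> (Sup k)) - \<xi> (\<phi> (Inf k))))" .
    have "\<Union>(G ` d) \<subseteq> {a'..b'}" using k by fastforce
    then show "(\<Sum>k\<in>d. norm (\<xi> (\<phi> (Sup k)) - \<xi> (\<phi> (Inf k)))) < \<epsilon>"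
      using \<delta>(2)[rule_format, OF div _ len] eq by simp
  qed (rule \<delta>)
qed

lemma abs_cont_on_subinterval:
  assumes "abs_cont_on a b \<xi>" "a \<le> c" "d \<le> b"
  shows "abs_cont_on c d \<xi>"
  using assms by (intro abs_cont_on_compose_mono[of a b \<xi> c d "\<lambda>s. s"]) auto

lemma abs_cont_on_cong:
  assumes "abs_cont_on a b \<xi>" "\<And>s. s \<in> {a..b} \<Longrightarrow> \<xi> s = \<eta> s"
  shows "abs_cont_on a b \<eta>"
proof (rule abs_cont_onI)
  fix \<epsilon> :: real assume \<epsilon>: "\<epsilon> > 0"
  have eq: "(\<Sum>k\<in>d. norm (\<eta> (Sup k) - \<eta> (Inf k))) = (\<Sum>k\<in>d. norm (\<xi> (Sup k) - \<xi> (Inf k)))"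
    if d: "d division_of \<Union>d" "\<Union>d \<subseteq> {a..b}" for d
  proof (intro sum.cong refl)
    fix k assume k: "k \<in> d"
    obtain u v where uv: "k = {u..v}" "u \<le> v"
      using division_ofD(3,4)[OF d(1) k] by (force simp: cbox_interval)
    then have "{u..v} \<subseteq> {a..b}" using d(2) k by blast
    then show "norm (\<eta> (Sup k) - \<eta> (Inf k)) = norm (\<xi> (Sup k) - \<xi> (Inf k))"
      using uv assms(2)[of u] assms(2)[of v] by simp
  qed
  show "\<exists>\<delta>>0. \<forall>d. d division_of \<Union>d \<longrightarrow> \<Union>d \<subseteq> {a..b} \<longrightarrow> (\<Sum>k\<in>d. Sup k - Inf k) < \<delta> \<longrightarrow>
      (\<Sum>k\<in>d. norm (\<eta> (Sup k) - \<eta> (Inf k))) < \<epsilon>"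
    using abs_cont_onD[OF assms(1) \<epsilon>] by (simp add: eq cong: imp_cong)
qed

text \<open>Writing the glued curve as a sum of two clamped curves and a constant avoids splitting
  the cells of a division at c.\<close>

lemma abs_cont_on_join:
  fixes \<xi> :: "real \<Rightarrow> 'a::real_normed_vector"
  assumes "abs_cont_on a c \<xi>" "abs_cont_on c b \<eta>" "\<xi> c = \<eta> c" "a \<le> c" "c \<le> b"
  shows "abs_cont_on a b (\<lambda>s. if s \<le> c then \<xi> s else \<eta> s)"
proof (rule abs_cont_on_cong)
  have "abs_cont_on a b (\<lambda>s. \<xi> (min s c))"
    by (rule abs_cont_on_compose_mono[OF assms(1)]) (use assms(4,5) in auto)
  moreover have "abs_cont_on a b (\<lambda>s. \<eta> (max s c))"
    by (rule abs_cont_on_compose_mono[OF assms(2)]) (use assms(4,5) in auto)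
  moreover have "abs_cont_on a b (\<lambda>_. - \<eta> c)"
    by (rule abs_cont_on_Lipschitz[of _ _ _ 0]) simp
  ultimately show "abs_cont_on a b (\<lambda>s. \<xi> (min s c) + \<eta> (max s c) + - \<eta> c)"
    by (intro abs_cont_on_add)
  show "\<xi> (min s c) + \<eta> (max s c) + - \<eta> c = (if s \<le> c then \<xi> s else \<eta> s)" for s
    using assms(3) by (auto simp: min_def max_def)
qed

text \<open>The lifts of the two pieces may differ at c by an integer vector. Translating the second
  lift by it makes them meet without changing the projected curve.\<close>

lemma torus_abs_cont_on_join:
  assumes \<zeta>: "torus_abs_cont_on a c \<zeta>" and \<eta>: "torus_abs_cont_on c b \<eta>"
    and eq: "\<zeta> c = \<eta> c" and ac: "a \<le> c" and cb: "c \<le> b"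
  shows "torus_abs_cont_on a b (\<lambda>s. if s \<le> c then \<zeta> s else \<eta> s)"
proof -
  obtain \<xi>1 where \<xi>1: "abs_cont_on a c \<xi>1" "\<And>s. s \<in> {a..c} \<Longrightarrow> \<zeta> s = torus_of (\<xi>1 s)"
    using \<zeta> unfolding torus_abs_cont_on_def by blast
  obtain \<xi>2 where \<xi>2: "abs_cont_on c b \<xi>2" "\<And>s. s \<in> {c..b} \<Longrightarrow> \<eta> s = torus_of (\<xi>2 s)"
    using \<eta> unfolding torus_abs_cont_on_def by blast
  have "torus_of (\<xi>1 c) = torus_of (\<xi>2 c)" using \<xi>1(2)[of c] \<xi>2(2)[of c] ac cb eq by simp
  then have shift: "torus_of (\<xi>2 s + (\<xi>1 c - \<xi>2 c)) = torus_of (\<xi>2 s)" for s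
    by (simp add: torus_of_eq_iff)
  have "abs_cont_on c b (\<lambda>_. \<xi>1 c - \<xi>2 c)" by (rule abs_cont_on_Lipschitz[of _ _ _ 0]) simp
  then have "abs_cont_on a b (\<lambda>s. if s \<le> c then \<xi>1 s else \<xi>2 s + (\<xi>1 c - \<xi>2 c))"
    using \<xi>1(1) \<xi>2(1) ac cb by (intro abs_cont_on_join abs_cont_on_add) auto
  then show ?thesis
    unfolding torus_abs_cont_on_def using \<xi>1(2) \<xi>2(2) shift
    by (intro exI[of _ "\<lambda>s. if s \<le> c then \<xi>1 s else \<xi>2 s + (\<xi>1 c - \<xi>2 c)"]) auto
qed

lemma torus_abs_cont_on_subinterval:
  "torus_abs_cont_on a b \<zeta> \<Longrightarrow> a \<le> c \<Longrightarrow> d \<le> b \<Longrightarrow> torus_abs_cont_on c d \<zeta>"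
  unfolding torus_abs_cont_on_def by (meson abs_cont_on_subinterval atLeastAtMost_iff order_trans)

lemma torus_abs_cont_on_line: "torus_abs_cont_on a b (\<lambda>s. torus_of (y + (s - a) *\<^sub>R w))"
proof -
  have "abs_cont_on a b (\<lambda>s. y + (s - a) *\<^sub>R w)"
  proof (rule abs_cont_on_Lipschitz)
    show "norm (y + (t - a) *\<^sub>R w - (y + (s - a) *\<^sub>R w)) \<le> norm w * \<bar>t - s\<bar>" for s t
      by (simp add: algebra_simps flip: scaleR_diff_left)
  qed
  then show ?thesis unfolding torus_abs_cont_on_def by blast
qed

section \<open>Action of subarcs and of concatenated curves\<close>

lemma action_eq_ereal_iff:
  "action L a b \<zeta> = ereal A \<longleftrightarrow> torus_abs_cont_on a b \<zeta> \<and>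
    (\<lambda>s. L (\<zeta> s) s (torus_velocity \<zeta> s)) absolutely_integrable_on {a..b} \<and>
    integral {a..b} (\<lambda>s. L (\<zeta> s) s (torus_velocity \<zeta> s)) = A"
  by (auto simp: action_def)

lemma action_cases: "action L a b \<zeta> = \<infinity> \<or> (\<exists>A. action L a b \<zeta> = ereal A)"
  by (auto simp: action_def)

lemma action_subinterval:
  assumes "action L a b \<zeta> = ereal A" "a \<le> c" "d \<le> b"
  shows "action L c d \<zeta> = ereal (integral {c..d} (\<lambda>s. L (\<zeta> s) s (torus_velocity \<zeta> s)))"
  using assms unfolding action_eq_ereal_iff
  by (meson absolutely_integrable_on_subinterval torus_abs_cont_on_subinterval atLeastatMost_subset_iff)

text \<open>Velocity is a local notion, so the integrand of the glued curve agrees with those of the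
  pieces except possibly at time c, a null set.\<close>

lemma action_join:
  assumes 1: "action L a c \<zeta> = ereal A" and 2: "action L c b \<eta> = ereal B"
    and eq: "\<zeta> c = \<eta> c" and ac: "a \<le> c" and cb: "c \<le> b"
  shows "action L a b (\<lambda>s. if s \<le> c then \<zeta> s else \<eta> s) = ereal (A + B)"
proof -
  define \<gamma> where "\<gamma> s = (if s \<le> c then \<zeta> s else \<eta> s)" for s
  define F where "F \<theta> s = L (\<theta> s) s (torus_velocity \<theta> s)" for \<theta> s
  note act1 = 1[unfolded action_eq_ereal_iff, folded F_def]
  note act2 = 2[unfolded action_eq_ereal_iff, folded F_def]
  have left: "F \<gamma> s = F \<zeta> s" if "s < c" for s
  proof -
    have "\<forall>\<^sub>F r in nhds s. r \<in> {..<c}" using that by (intro eventually_nhds_in_open) auto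
    then have "torus_velocity \<gamma> s = torus_velocity \<zeta> s"
      by (intro torus_velocity_local) (auto simp: \<gamma>_def elim!: eventually_mono)
    then show ?thesis using that by (simp add: F_def \<gamma>_def)
  qed
  have right: "F \<gamma> s = F \<eta> s" if "s > c" for s
  proof -
    have "\<forall>\<^sub>F r in nhds s. r \<in> {c<..}" using that by (intro eventually_nhds_in_open) auto
    then have "torus_velocity \<gamma> s = torus_velocity \<eta> s"
      by (intro torus_velocity_local) (auto simp: \<gamma>_def elim!: eventually_mono)
    then show ?thesis using that by (simp add: F_def \<gamma>_def)
  qed
  have i1: "F \<gamma> absolutely_integrable_on {a..c}"
    by (rule absolutely_integrable_spike[where f = "F \<zeta>" and S = "{c}"]) (use act1 left in auto)
  have i2: "F \<gamma> absolutely_integrable_on {c..b}"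
    by (rule absolutely_integrable_spike[where f = "F \<eta>" and S = "{c}"]) (use act2 right in auto)
  have "F \<gamma> absolutely_integrable_on ({a..c} \<union> {c..b})"
    by (rule absolutely_integrable_Un[OF i1 i2])
  moreover have "{a..c} \<union> {c..b} = {a..b}" using ac cb by auto
  ultimately have i: "F \<gamma> absolutely_integrable_on {a..b}" by simp
  have "integral {a..c} (F \<gamma>) = integral {a..c} (F \<zeta>)"
    by (rule integral_spike[of "{c}"]) (use left in auto)
  moreover have "integral {c..b} (F \<gamma>) = integral {c..b} (F \<eta>)"
    by (rule integral_spike[of "{c}"]) (use right in auto)
  ultimately have "integral {a..b} (F \<gamma>) = A + B"
    using Henstock_Kurzweil_Integration.integral_combine[OF ac cb set_lebesgue_integral_eq_integral(1)[OF i]]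
      act1 act2 by simp
  moreover have "torus_abs_cont_on a b \<gamma>"
    unfolding \<gamma>_def using act1 act2 eq ac cb by (intro torus_abs_cont_on_join) auto
  ultimately show ?thesis
    using i unfolding \<gamma>_def[symmetric] action_eq_ereal_iff F_def[abs_def] by simp
qed

context superlinear_hamiltonian
begin

lemma line_integrand_continuous:
  assumes "0 \<le> a" "b \<le> T"
  shows "continuous_on {a..b} (\<lambda>s. lagrangian H (torus_of (y + (s - a) *\<^sub>R w)) s w)"
proof -
  have "continuous_on {a..b} ((\<lambda>(y, t, q). lagrangian H (torus_of y) t q) \<circ>
      (\<lambda>s. (y + (s - a) *\<^sub>R w, s, w)))"
    by (intro continuous_on_compose continuous_intros continuous_on_subset[OF lagrangian_continuous])
      (use assms in auto)
  then show ?thesis by (simp add: comp_def)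
qed

lemma action_line:
  assumes "0 \<le> a" "b \<le> T"
  shows "action (lagrangian H) a b (\<lambda>s. torus_of (y + (s - a) *\<^sub>R w)) =
    ereal (integral {a..b} (\<lambda>s. lagrangian H (torus_of (y + (s - a) *\<^sub>R w)) s w))"
proof -
  have vel: "torus_velocity (\<lambda>s. torus_of (y + (s - a) *\<^sub>R w)) s = w" for s
  proof (rule torus_velocity_lift[of "s - 1" "s + 1"])
    show "((\<lambda>s. y + (s - a) *\<^sub>R w) has_vector_derivative w) (at s)"
      by (auto intro!: derivative_eq_intros)
  qed auto
  show ?thesis
    unfolding action_eq_ereal_iff vel
    using line_integrand_continuous[OF assms] torus_abs_cont_on_line
    by (auto intro: absolutely_integrable_continuous_real)
qed

end

section \<open>Dynamic programming\<close>

locale lax_oleinik_problem = superlinear_hamiltonian H T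
  for H :: "('n::finite) torus \<Rightarrow> real \<Rightarrow> real ^ 'n \<Rightarrow> real" and T :: real +
  fixes g :: "'n torus \<Rightarrow> real"
  assumes T_pos: "0 < T" and g_cont: "continuous_on UNIV g"
begin

abbreviation "L \<equiv> lagrangian H"
abbreviation "v \<equiv> lax_oleinik H g T"

definition running_cost :: "(real \<Rightarrow> 'n torus) \<Rightarrow> real \<Rightarrow> real"
  where "running_cost \<zeta> s = L (\<zeta> s) s (torus_velocity \<zeta> s)"

section \<open>Finiteness of the value function and near-minimisers\<close>

lemma action_constant_finite:
  assumes "0 \<le> a" "b \<le> T"
  shows "\<exists>A. action L a b (\<lambda>_. x) = ereal A"
proof -
  obtain y where "torus_of y = x" using torus_of_surj by blast
  then show ?thesis using action_line[OF assms, of y 0] by auto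
qed

lemma cost_bounded_below:
  "\<exists>C. \<forall>t\<in>{0..T}. \<forall>\<zeta>. ereal C \<le> ereal (g (\<zeta> T)) + action L t T \<zeta>"
proof -
  obtain C where C: "C \<ge> 0" "\<And>x t q. t \<in> {0..T} \<Longrightarrow> - C \<le> L x t q"
    using lagrangian_bounded_below by blast
  have "compact (range g)" by (intro compact_continuous_image g_cont compact_torus)
  then have "bounded (range g)" by (rule compact_imp_bounded)
  then obtain G where G: "\<And>x. \<bar>g x\<bar> \<le> G" unfolding bounded_iff by auto
  have "ereal (- G - C * T) \<le> ereal (g (\<zeta> T)) + action L t T \<zeta>" if t: "t \<in> {0..T}" for t \<zeta>
  proof (cases "action L t T \<zeta> = \<infinity>")
    case False
    then obtain A where A: "action L t T \<zeta> = ereal A" using action_cases by blast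
    then have i: "(\<lambda>s. L (\<zeta> s) s (torus_velocity \<zeta> s)) integrable_on {t..T}"
      and A': "integral {t..T} (\<lambda>s. L (\<zeta> s) s (torus_velocity \<zeta> s)) = A"
      unfolding action_eq_ereal_iff by (auto intro: set_lebesgue_integral_eq_integral)
    have "integral {t..T} (\<lambda>_. - C) \<le> A"
      unfolding A'[symmetric] by (intro integral_le i) (use C(2) t in auto)
    then have "- (C * (T - t)) \<le> A" using t by (simp add: mult.commute)
    moreover have "C * (T - t) \<le> C * T" using C(1) t by (intro mult_left_mono) auto
    ultimately show ?thesis using G[of "\<zeta> T"] A by (simp add: abs_le_iff)
  qed simp
  then show ?thesis by blast
qed

text \<open>The constant curve bounds the infimum from above and \<open>cost_bounded_below\<close>
  bounds it from below. Hence \<open>real_of_ereal\<close> in \<open>lax_oleinik\<close> returns the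
  infimum itself and not its default value at infinity.\<close>

lemma value_ereal:
  assumes t: "t \<in> {0..<T}"
  shows "ereal (v x t) = (INF \<zeta>\<in>{\<zeta>. torus_abs_cont_on t T \<zeta> \<and> \<zeta> t = x}.
    ereal (g (\<zeta> T)) + action L t T \<zeta>)" (is "_ = ?I")
proof -
  obtain C where C: "\<And>\<zeta>. ereal C \<le> ereal (g (\<zeta> T)) + action L t T \<zeta>"
    using cost_bounded_below t by (meson atLeastAtMost_iff atLeastLessThan_iff less_imp_le)
  have "ereal C \<le> ?I" by (intro INF_greatest C)
  moreover obtain A where A: "action L t T (\<lambda>_. x) = ereal A"
    using action_constant_finite[of t T x] t by auto
  then have "?I \<le> ereal (g x) + ereal A"
    using A[unfolded action_eq_ereal_iff] by (intro INF_lower2[of "\<lambda>_. x"]) (simp_all add: A)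
  ultimately have "\<bar>?I\<bar> \<noteq> \<infinity>" by (cases ?I) auto
  then show ?thesis using t by (simp add: lax_oleinik_def ereal_real')
qed

lemma value_le:
  assumes t: "t \<in> {0..<T}" and A: "action L t T \<zeta> = ereal A"
  shows "v (\<zeta> t) t \<le> g (\<zeta> T) + A"
proof -
  have "ereal (v (\<zeta> t) t) \<le> ereal (g (\<zeta> T)) + action L t T \<zeta>"
    unfolding value_ereal[OF t] using A by (intro INF_lower) (auto simp: action_eq_ereal_iff)
  then show ?thesis using A by simp
qed

lemma value_approx:
  assumes t: "t \<in> {0..<T}" and \<epsilon>: "\<epsilon> > 0"
  obtains \<zeta> A where "action L t T \<zeta> = ereal A" "\<zeta> t = x" "g (\<zeta> T) + A < v x t + \<epsilon>"
proof -
  have "(INF \<zeta>\<in>{\<zeta>. torus_abs_cont_on t T \<zeta> \<and> \<zeta> t = x}. ereal (g (\<zeta> T)) + action L t T \<zeta>) <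
      ereal (v x t + \<epsilon>)"
    unfolding value_ereal[OF t, symmetric] using \<epsilon> by simp
  then obtain \<zeta> where \<zeta>: "\<zeta> t = x" "ereal (g (\<zeta> T)) + action L t T \<zeta> < ereal (v x t + \<epsilon>)"
    unfolding INF_less_iff by blast
  then obtain A where "action L t T \<zeta> = ereal A" using action_cases[of L t T \<zeta>] by auto
  with \<zeta> show ?thesis by (intro that) auto
qed

text \<open>Following \<zeta> up to time b and a near-minimiser from \<zeta>(b) afterwards gives a
  competitor for the value at time a.\<close>

lemma dynamic_programming_le:
  assumes a: "0 \<le> a" "a \<le> b" "b < T" and A: "action L a b \<zeta> = ereal A"
  shows "v (\<zeta> a) a \<le> A + v (\<zeta> b) b"
proof (rule field_le_epsilon)
  fix \<epsilon> :: real assume \<epsilon>: "\<epsilon> > 0"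
  obtain \<eta> B where \<eta>: "action L b T \<eta> = ereal B" "\<eta> b = \<zeta> b" "g (\<eta> T) + B < v (\<zeta> b) b + \<epsilon>"
    using value_approx[of b \<epsilon>] a \<epsilon> by (metis atLeastLessThan_iff order_trans)
  define \<gamma> where "\<gamma> s = (if s \<le> b then \<zeta> s else \<eta> s)" for s
  have "action L a T \<gamma> = ereal (A + B)"
    unfolding \<gamma>_def by (rule action_join[OF A \<eta>(1)]) (use \<eta>(2) a in auto)
  then have "v (\<gamma> a) a \<le> g (\<gamma> T) + (A + B)" using a by (intro value_le) auto
  then show "v (\<zeta> a) a \<le> A + v (\<zeta> b) b + \<epsilon>" using \<eta>(3) a by (simp add: \<gamma>_def)
qed

text \<open>\<open>optimal_curve\<close> asks only for continuity. Comparison with the constant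
  curve yields finite action, and with it absolute continuity and an integrable running
  cost.\<close>

lemma optimal_action_finite:
  assumes "optimal_curve H g T \<zeta>"
  obtains A where "action L 0 T \<zeta> = ereal A"
proof -
  obtain A0 where "action L 0 T (\<lambda>_. \<zeta> 0) = ereal A0" using action_constant_finite[of 0 T] by auto
  moreover have "ereal (g (\<zeta> T)) + action L 0 T \<zeta> \<le> ereal (g (\<zeta> 0)) + action L 0 T (\<lambda>_. \<zeta> 0)"
    using assms unfolding optimal_curve_def by (elim conjE allE[of _ "\<lambda>_. \<zeta> 0"]) auto
  ultimately have "action L 0 T \<zeta> \<noteq> \<infinity>" by auto
  then show ?thesis using action_cases that by blast
qed

text \<open>A tail of an optimal curve is optimal: a cheaper tail, glued to the initial arc of
  \<zeta>, would give a cheaper curve from \<zeta>(0).\<close>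

lemma value_along_optimal:
  assumes opt: "optimal_curve H g T \<zeta>" and t: "t \<in> {0..<T}"
  shows "v (\<zeta> t) t = g (\<zeta> T) + integral {t..T} (running_cost \<zeta>)"
proof (rule antisym)
  obtain A where A: "action L 0 T \<zeta> = ereal A" using optimal_action_finite[OF opt] .
  have rest: "action L t T \<zeta> = ereal (integral {t..T} (running_cost \<zeta>))"
    unfolding running_cost_def[abs_def] using t by (intro action_subinterval[OF A]) auto
  show "v (\<zeta> t) t \<le> g (\<zeta> T) + integral {t..T} (running_cost \<zeta>)"
    by (rule value_le[OF t rest])
  have initial: "action L 0 t \<zeta> = ereal (integral {0..t} (running_cost \<zeta>))"
    unfolding running_cost_def[abs_def] using t by (intro action_subinterval[OF A]) auto
  have i: "running_cost \<zeta> integrable_on {0..T}" and A': "A = integral {0..T} (running_cost \<zeta>)"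
    using A unfolding action_eq_ereal_iff running_cost_def[abs_def]
    by (auto intro: set_lebesgue_integral_eq_integral)
  have split: "A = integral {0..t} (running_cost \<zeta>) + integral {t..T} (running_cost \<zeta>)"
    unfolding A' using t i by (intro Henstock_Kurzweil_Integration.integral_combine[symmetric]) auto
  show "g (\<zeta> T) + integral {t..T} (running_cost \<zeta>) \<le> v (\<zeta> t) t"
  proof (rule field_le_epsilon)
    fix \<epsilon> :: real assume \<epsilon>: "\<epsilon> > 0"
    obtain \<eta> B where \<eta>: "action L t T \<eta> = ereal B" "\<eta> t = \<zeta> t" "g (\<eta> T) + B < v (\<zeta> t) t + \<epsilon>"
      using value_approx[OF t \<epsilon>] by metis
    define \<gamma> where "\<gamma> s = (if s \<le> t then \<zeta> s else \<eta> s)" for s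
    have \<gamma>: "action L 0 T \<gamma> = ereal (integral {0..t} (running_cost \<zeta>) + B)"
      unfolding \<gamma>_def by (rule action_join[OF initial \<eta>(1)]) (use \<eta>(2) t in auto)
    then have "continuous_on {0..T} \<gamma>"
      by (intro torus_abs_cont_on_continuous) (simp add: action_eq_ereal_iff)
    moreover have "\<gamma> 0 = \<zeta> 0" "\<gamma> T = \<eta> T" using t by (auto simp: \<gamma>_def)
    ultimately have "ereal (g (\<zeta> T)) + action L 0 T \<zeta> \<le> ereal (g (\<eta> T)) + action L 0 T \<gamma>"
      using opt unfolding optimal_curve_def by (metis (no_types))
    then have "g (\<zeta> T) + A \<le> g (\<eta> T) + (integral {0..t} (running_cost \<zeta>) + B)"
      using A \<gamma> by simp
    then show "g (\<zeta> T) + integral {t..T} (running_cost \<zeta>) \<le> v (\<zeta> t) t + \<epsilon>"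
      using \<eta>(3) split by simp
  qed
qed

text \<open>Dynamic programming along a straight segment, with its cost per unit time frozen at (y0,
  t, q). The threshold d is uniform in endpoints and velocity, so the segment may vary with the
  scale. The last premise keeps it within d of y0.\<close>

lemma value_line_le:
  assumes t: "t \<in> {0<..<T}" and \<epsilon>: "\<epsilon> > 0"
  shows "\<exists>d>0. \<forall>a b y w. \<bar>a - t\<bar> < d \<longrightarrow> \<bar>b - t\<bar> < d \<longrightarrow> a \<le> b \<longrightarrow> norm (w - q) < d \<longrightarrow>
    norm (y - y0) + (b - a) * norm w < d \<longrightarrow>
    v (torus_of y) a \<le> (b - a) * (L (torus_of y0) t q + \<epsilon>) + v (torus_of (y + (b - a) *\<^sub>R w)) b"
proof -
  define l where "l = L (torus_of y0) t q"
  obtain d where d: "d > 0" "\<And>y s w. s \<in> {0..T} \<Longrightarrow> norm (y - y0) < d \<Longrightarrow> \<bar>s - t\<bar> < d \<Longrightarrow>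
      norm (w - q) < d \<Longrightarrow> L (torus_of y) s w \<le> l + \<epsilon>"
    using lagrangian_locally_le[of t \<epsilon> y0 q] t \<epsilon> unfolding l_def by auto
  \<comment> \<open>The bounds t and T - t keep the segment inside the time interval [0, T).\<close>
  define d' where "d' = min d (min t (T - t))"
  have d': "d' > 0" "d' \<le> d" "d' \<le> t" "d' \<le> T - t" using d(1) t by (auto simp: d'_def min_def)
  have "v (torus_of y) a \<le> (b - a) * (l + \<epsilon>) + v (torus_of (y + (b - a) *\<^sub>R w)) b"
    if ab: "\<bar>a - t\<bar> < d'" "\<bar>b - t\<bar> < d'" "a \<le> b" and w: "norm (w - q) < d'"
      and y: "norm (y - y0) + (b - a) * norm w < d'" for a b y w
  proof -
    have a0: "0 \<le> a" "b < T" using ab d' by auto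
    define I where "I = integral {a..b} (\<lambda>s. L (torus_of (y + (s - a) *\<^sub>R w)) s w)"
    have "v (torus_of (y + (a - a) *\<^sub>R w)) a \<le> I + v (torus_of (y + (b - a) *\<^sub>R w)) b"
      unfolding I_def
      by (rule dynamic_programming_le[OF a0(1) ab(3) a0(2) action_line]) (use a0 in auto)
    moreover have "I \<le> integral {a..b} (\<lambda>_. l + \<epsilon>)"
      unfolding I_def
    proof (rule integral_le)
      show "(\<lambda>s. L (torus_of (y + (s - a) *\<^sub>R w)) s w) integrable_on {a..b}"
        using a0 by (intro integrable_continuous_real line_integrand_continuous) auto
      fix s assume s: "s \<in> {a..b}"
      have "norm (y + (s - a) *\<^sub>R w - y0) \<le> norm (y - y0) + norm ((s - a) *\<^sub>R w)"
        using norm_triangle_ineq[of "y - y0" "(s - a) *\<^sub>R w"] by (simp add: algebra_simps)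
      also have "norm ((s - a) *\<^sub>R w) \<le> (b - a) * norm w" using s by (simp add: mult_right_mono)
      finally have "norm (y + (s - a) *\<^sub>R w - y0) < d" using y d' by linarith
      then show "L (torus_of (y + (s - a) *\<^sub>R w)) s w \<le> l + \<epsilon>"
        using s ab w d' a0 by (intro d(2)) auto
    qed auto
    ultimately show ?thesis using ab(3) by simp
  qed
  then show ?thesis using d'(1) unfolding l_def by blast
qed

end

section \<open>Generalized velocities\<close>

text \<open>Along the segment to y, convexity bounds the difference quotients by f(y) - f(x); their
  limit is the directional derivative.\<close>

lemma convex_gradient_le:
  fixes f :: "'a::real_inner \<Rightarrow> real"
  assumes conv: "convex_on UNIV f" and deriv: "GDERIV f x :> D"
  shows "f x + inner D (y - x) \<le> f y"
proof -
  have "((\<lambda>s. (f (x + s *\<^sub>R (y - x)) - f x) / s) \<longlongrightarrow> inner (y - x) D) (at_right 0)"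
  proof -
    have "(f has_derivative (\<lambda>h. inner h D)) (at x)" using deriv by (simp add: gderiv_def)
    then have "((\<lambda>s. f (x + s *\<^sub>R (y - x))) has_derivative (\<lambda>s. inner (s *\<^sub>R (y - x)) D)) (at 0)"
      by (intro has_derivative_compose[of "\<lambda>s. x + s *\<^sub>R (y - x)" "\<lambda>s. s *\<^sub>R (y - x)" 0 UNIV f])
        (auto intro!: derivative_eq_intros)
    then have "((\<lambda>s. f (x + s *\<^sub>R (y - x))) has_real_derivative inner (y - x) D) (at 0)"
      by (simp add: has_field_derivative_def mult.commute[of _ "inner (y - x) D"])
    then show ?thesis
      by (auto simp: has_field_derivative_iff filterlim_at_split)
  qed
  moreover have "\<forall>\<^sub>F s in at_right 0. (f (x + s *\<^sub>R (y - x)) - f x) / s \<le> f y - f x"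
  proof -
    have "\<forall>\<^sub>F s :: real in at_right 0. s \<in> {0<..<1}" by (rule eventually_at_right_real) simp
    then show ?thesis
    proof eventually_elim
      case (elim s)
      have "f ((1 - s) *\<^sub>R x + s *\<^sub>R y) \<le> (1 - s) * f x + s * f y"
        using elim by (intro convex_onD[OF conv]) auto
      moreover have "(1 - s) *\<^sub>R x + s *\<^sub>R y = x + s *\<^sub>R (y - x)" by (simp add: algebra_simps)
      ultimately show ?case using elim by (simp add: field_simps)
    qed
  qed
  ultimately have "inner (y - x) D \<le> f y - f x"
    by (rule tendsto_upperbound) simp
  then show ?thesis by (simp add: inner_commute)
qed

text \<open>Subtracting the supporting affine function leaves a function with a minimum at x, so the
  derivative in direction D - q vanishes.\<close>

lemma supporting_slope_eq_gradient:
  fixes f :: "'a::real_inner \<Rightarrow> real"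
  assumes deriv: "GDERIV f x :> D" and support: "\<And>y. f x + inner q (y - x) \<le> f y"
  shows "q = D"
proof -
  have "((\<lambda>y. f y - inner q (y - x)) has_derivative (\<lambda>h. inner h D - inner q h)) (at x)"
    using deriv unfolding gderiv_def by (auto intro!: derivative_eq_intros)
  moreover have "\<forall>y. f x - inner q (x - x) \<le> f y - inner q (y - x)"
  proof
    fix y show "f x - inner q (x - x) \<le> f y - inner q (y - x)" using support[of y] by simp
  qed
  ultimately have "(\<lambda>h. inner h D - inner q h) = (\<lambda>h. 0)"
    by (intro has_derivative_local_min[of "\<lambda>y. f y - inner q (y - x)" _ x]) auto
  then have "inner (D - q) D - inner q (D - q) = 0" by meson
  then have "inner (D - q) (D - q) = 0" by (simp add: inner_diff inner_commute)
  then show ?thesis by simp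
qed

text \<open>A is arbitrary, so a Borel subset must be built: enlarge N to a Borel null set and keep
  the part of the graph over the remaining times E. The graph is compact, hence closed, and the
  curve spends exactly the times E in this part.\<close>

lemma graph_full_occupation:
  fixes \<zeta> :: "real \<Rightarrow> ('n::finite) torus"
  assumes T_pos: "0 < T" and cont: "continuous_on {0..T} \<zeta>" and N: "negligible N"
    and A: "\<And>t. t \<in> {0<..<T} - N \<Longrightarrow> (\<zeta> t, t) \<in> A"
  shows "\<exists>S \<in> sets borel. S \<subseteq> A \<and> occupation T \<zeta> S = 1"
proof -
  have "N \<in> null_sets (completion lborel)" using N by (simp add: negligible_iff_null_sets)
  then obtain N' where N': "N' \<in> null_sets lborel" "N \<subseteq> N'"
    by (metis null_sets_completion_iff2)
  define E where "E = {0<..<T} - N'"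
  have N'b: "N' \<in> sets borel" using N'(1) by (simp add: null_sets_def)
  then have E: "E \<in> sets borel" by (simp add: E_def)
  define S where "S = (\<lambda>t. (\<zeta> t, t)) ` {0..T} \<inter> snd -` E"
  have "compact ((\<lambda>t. (\<zeta> t, t)) ` {0..T})"
    using cont by (intro compact_continuous_image continuous_intros) auto
  then have "closed ((\<lambda>t. (\<zeta> t, t)) ` {0..T})" by (rule compact_imp_closed)
  moreover have "snd \<in> borel_measurable (borel :: ('n torus \<times> real) measure)"
    by (intro borel_measurable_continuous_onI continuous_intros)
  from measurable_sets[OF this E] have "snd -` E \<in> sets (borel :: ('n torus \<times> real) measure)"
    by simp
  ultimately have "S \<in> sets borel" unfolding S_def by (intro sets.Int) auto
  moreover have "S \<subseteq> A" using N'(2) by (auto simp: S_def E_def intro!: A)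
  moreover have "{t \<in> {0..T}. (\<zeta> t, t) \<in> S} = E" by (auto simp: S_def E_def)
  then have "occupation T \<zeta> S = measure lborel E / T" by (simp add: occupation_def)
  moreover have "measure lborel E = T"
  proof -
    have "emeasure lborel E = emeasure lborel {0<..<T}"
      unfolding E_def by (rule emeasure_Diff_null_set[OF N'(1)]) simp
    then show ?thesis using T_pos by (simp add: measure_def)
  qed
  ultimately show ?thesis using T_pos by auto
qed

context lax_oleinik_problem
begin

text \<open>Comparing \<open>v\<close> at \<open>(x + h q, t + h)\<close> with its values along the curve at times \<open>t\<close> and
  \<open>t + 2 h\<close> requires no regularity of \<open>v\<close>: the short segments involved have velocity close
  to \<open>q\<close>, so by continuity of the Lagrangian their cost per unit time is close to
  \<open>L (x, t, q)\<close>.\<close>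

lemma spacetime_deriv_along_curve:
  assumes t: "t \<in> {0<..<T}"
    and lift: "\<And>s. s \<in> {0..T} \<Longrightarrow> \<zeta> s = torus_of (\<xi> s)"
    and \<xi>: "(\<xi> has_vector_derivative q) (at t)"
    and V: "((\<lambda>s. v (\<zeta> s) s) has_real_derivative - L (\<zeta> t) t q) (at t)"
  shows "has_spacetime_deriv v (\<zeta> t) t q (- L (\<zeta> t) t q)"
proof -
  define y0 where "y0 = \<xi> t"
  define l where "l = L (torus_of y0) t q"
  have \<zeta>t: "\<zeta> t = torus_of y0" using lift t by (simp add: y0_def)
  \<comment> \<open>In the factor 3, one \<epsilon> |h| pays for the segment joining the point to
    the curve and two pay for the value along the curve at distance 2 |h| from t.\<close>
  have main: "\<exists>d>0. \<forall>h. h \<noteq> 0 \<longrightarrow> \<bar>h\<bar> < d \<longrightarrow>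
    \<bar>v (torus_of (y0 + h *\<^sub>R q)) (t + h) - v (torus_of y0) t + h * l\<bar> \<le> 3 * \<epsilon> * \<bar>h\<bar>" if \<epsilon>: "\<epsilon> > 0" for \<epsilon>
  proof -
    obtain d0 where d0: "d0 > 0"
      "\<And>a b y w. \<bar>a - t\<bar> < d0 \<Longrightarrow> \<bar>b - t\<bar> < d0 \<Longrightarrow> a \<le> b \<Longrightarrow> norm (w - q) < d0 \<Longrightarrow>
        norm (y - y0) + (b - a) * norm w < d0 \<Longrightarrow>
        v (torus_of y) a \<le> (b - a) * (l + \<epsilon>) + v (torus_of (y + (b - a) *\<^sub>R w)) b"
      using value_line_le[OF t \<epsilon>, of q y0] unfolding l_def by blast
    obtain d1 where d1: "d1 > 0"
      "\<And>s. norm (s - t) < d1 \<Longrightarrow> norm (\<xi> s - \<xi> t - (s - t) *\<^sub>R q) \<le> d0 / 4 * norm (s - t)"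
      using \<xi> d0(1) unfolding has_vector_derivative_def has_derivative_at_alt
      by (metis divide_pos_pos zero_less_numeral)
    obtain d2 where d2: "d2 > 0"
      "\<And>s. norm (s - t) < d2 \<Longrightarrow> norm (v (\<zeta> s) s - v (\<zeta> t) t - (- l) * (s - t)) \<le> \<epsilon> * norm (s - t)"
      using V \<epsilon> unfolding has_field_derivative_def has_derivative_at_alt \<zeta>t l_def[symmetric] by blast
    \<comment> \<open>The halves are there because the curve is evaluated at distance 2 |h| from t,
      which must stay in [0, T]. The last entry bounds the lengths of the segments, whose velocities
      lie within d0 / 2 of q.\<close>
    define d where "d = Min {d0 / 4, d1 / 2, d2 / 2, t / 2, (T - t) / 2, d0 / (4 * (norm q + d0 + 1))}"
    have "norm q + d0 + 1 > 0" using d0(1) by (simp add: add_nonneg_pos)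
    then have d_pos: "d > 0" unfolding d_def using d0(1) d1(1) d2(1) t by (subst Min_gr_iff) simp_all
    have d_le: "d \<le> d0 / 4" "d \<le> d1 / 2" "d \<le> d2 / 2" "d \<le> t / 2" "d \<le> (T - t) / 2"
      "d \<le> d0 / (4 * (norm q + d0 + 1))"
      unfolding d_def by (rule Min_le; simp)+
    note d = d_pos d_le
    have small: "h * norm q + h * (d0 + 1) \<le> d0 / 4" if "0 < h" "h < d" for h
    proof -
      have "h * (norm q + d0 + 1) \<le> d0 / (4 * (norm q + d0 + 1)) * (norm q + d0 + 1)"
        using that d d0(1) by (intro mult_right_mono) auto
      also have "\<dots> = d0 / 4" using d0(1) by (simp add: field_simps add_nonneg_eq_0_iff)
      finally show ?thesis by (simp add: algebra_simps)
    qed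
    have V_near: "\<bar>v (torus_of (\<xi> (t + s))) (t + s) - v (torus_of y0) t + l * s\<bar> \<le> \<epsilon> * \<bar>s\<bar>"
      if "\<bar>s\<bar> < 2 * d" for s
    proof -
      have "t + s \<in> {0..T}" using that d by auto
      then show ?thesis using d2(2)[of "t + s"] that d lift[of "t + s"] \<zeta>t by simp
    qed
    have \<xi>_near: "norm (\<xi> (t + s) - y0 - s *\<^sub>R q) \<le> d0 / 4 * \<bar>s\<bar>" if "\<bar>s\<bar> < 2 * d" for s
      using d1(2)[of "t + s"] that d by (auto simp: y0_def)
    have "\<bar>v (torus_of (y0 + h *\<^sub>R q)) (t + h) - v (torus_of y0) t + h * l\<bar> \<le> 3 * \<epsilon> * \<bar>h\<bar>"
      if h: "h \<noteq> 0" "\<bar>h\<bar> < d" for h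
    proof -
      define k where "k = \<bar>h\<bar>"
      have k: "k > 0" "k < d" using h by (auto simp: k_def)
      have "k * d0 > 0" using k d0(1) by simp
      then have kq: "k * norm q \<le> d0 / 4" and kd: "k * d0 \<le> d0 / 4 - k * norm q"
        using small[OF k] k unfolding distrib_left mult_1_right by linarith+
      show ?thesis
      proof (cases "h > 0")
        case True
        then have hk: "h = k" by (simp add: k_def)
        have "v (torus_of y0) t \<le> k * (l + \<epsilon>) + v (torus_of (y0 + k *\<^sub>R q)) (t + k)"
          using d0(2)[of t "t + k" q y0] k d d0(1) kq by simp
        \<comment> \<open>The velocity that rejoins the curve at time t + 2k from (y0 + kq, t + k).
          The extra time k is essential: the o(k) gap between the curve and its tangent line, spread
          over time k, changes the velocity only by o(1).\<close>
        moreover define w where "w = (1 / k) *\<^sub>R (\<xi> (t + 2 * k) - y0 - k *\<^sub>R q)"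
        have kw: "k *\<^sub>R w = \<xi> (t + 2 * k) - y0 - k *\<^sub>R q" using k by (simp add: w_def)
        have wq: "norm (w - q) \<le> d0 / 2"
        proof -
          have "k * norm (w - q) = norm (k *\<^sub>R (w - q))" using k by simp
          also have "k *\<^sub>R (w - q) = \<xi> (t + 2 * k) - y0 - (2 * k) *\<^sub>R q"
            by (simp add: scaleR_diff_right kw algebra_simps scaleR_2 flip: scaleR_scaleR)
          also have "norm \<dots> \<le> k * (d0 / 2)" using \<xi>_near[of "2 * k"] k by (simp add: mult.commute)
          finally show ?thesis using k by simp
        qed
        then have "norm w \<le> norm q + d0 / 2" using norm_triangle_ineq2[of w q] by simp
        then have "k * norm w \<le> k * (norm q + d0 / 2)" using k by (intro mult_left_mono) auto
        then have "norm (y0 + k *\<^sub>R q - y0) + k * norm w < d0"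
          using kq kd k d0(1) by (simp add: algebra_simps)
        then have "v (torus_of (y0 + k *\<^sub>R q)) (t + k) \<le>
            k * (l + \<epsilon>) + v (torus_of (y0 + k *\<^sub>R q + k *\<^sub>R w)) (t + 2 * k)"
          using d0(2)[of "t + k" "t + 2 * k" w "y0 + k *\<^sub>R q"] k d d0(1) wq by simp
        moreover have "y0 + k *\<^sub>R q + k *\<^sub>R w = \<xi> (t + 2 * k)" by (simp add: kw)
        ultimately show ?thesis
          using V_near[of "2 * k"] k unfolding hk by (simp add: abs_le_iff algebra_simps)
      next
        case False
        then have hk: "h = - k" by (simp add: k_def)
        have "norm (y0 + h *\<^sub>R q - y0) + k * norm q < d0" using kq k d0(1) hk by simp
        then have upper: "v (torus_of (y0 + h *\<^sub>R q)) (t + h) \<le> k * (l + \<epsilon>) + v (torus_of y0) t"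
          using d0(2)[of "t + h" t q "y0 + h *\<^sub>R q"] k d d0(1) hk by simp
        \<comment> \<open>Mirror image for h < 0: the segment leaves the curve at time t - 2k and
          reaches y0 - kq at time t - k, so it now gives the lower bound.\<close>
        define w where "w = (1 / k) *\<^sub>R (y0 + h *\<^sub>R q - \<xi> (t + - 2 * k))"
        have kw: "k *\<^sub>R w = y0 + h *\<^sub>R q - \<xi> (t + - 2 * k)" using k by (simp add: w_def)
        have wq: "norm (w - q) \<le> d0 / 2"
        proof -
          have "k * norm (w - q) = norm (k *\<^sub>R (w - q))" using k by simp
          also have "k *\<^sub>R (w - q) = - (\<xi> (t + - 2 * k) - y0 - (- 2 * k) *\<^sub>R q)"
            by (simp add: scaleR_diff_right kw hk algebra_simps scaleR_2 flip: scaleR_scaleR)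
          also have "norm \<dots> \<le> k * (d0 / 2)"
            unfolding norm_minus_cancel using \<xi>_near[of "- 2 * k"] k by (simp add: mult.commute)
          finally show ?thesis using k by simp
        qed
        then have "norm w \<le> norm q + d0 / 2" using norm_triangle_ineq2[of w q] by simp
        then have "k * norm w \<le> k * (norm q + d0 / 2)" using k by (intro mult_left_mono) auto
        moreover have "norm (\<xi> (t + - 2 * k) - y0) \<le> 2 * k * norm q + k * (d0 / 2)"
        proof -
          have "norm (\<xi> (t + - 2 * k) - y0) \<le>
              norm (\<xi> (t + - 2 * k) - y0 - (- 2 * k) *\<^sub>R q) + norm ((- 2 * k) *\<^sub>R q)"
            using norm_triangle_ineq[of "\<xi> (t + - 2 * k) - y0 - (- 2 * k) *\<^sub>R q" "(- 2 * k) *\<^sub>R q"]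
            by simp
          then show ?thesis using \<xi>_near[of "- 2 * k"] k by (simp add: mult.commute)
        qed
        ultimately have "norm (\<xi> (t + - 2 * k) - y0) + k * norm w < d0"
          using kq kd k d0(1) by (simp add: algebra_simps)
        then have "v (torus_of (\<xi> (t + - 2 * k))) (t + - 2 * k) \<le>
            k * (l + \<epsilon>) + v (torus_of (\<xi> (t + - 2 * k) + k *\<^sub>R w)) (t + h)"
          using d0(2)[of "t + - 2 * k" "t + h" w "\<xi> (t + - 2 * k)"] k d d0(1) wq hk by simp
        moreover have eq: "\<xi> (t + - 2 * k) + k *\<^sub>R w = y0 + h *\<^sub>R q" by (simp add: kw)
        ultimately have lower: "v (torus_of (\<xi> (t + - 2 * k))) (t + - 2 * k) \<le>
            k * (l + \<epsilon>) + v (torus_of (y0 + h *\<^sub>R q)) (t + h)"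
          by (simp only: eq)
        define V\<^sub>2 V\<^sub>1 where "V\<^sub>2 = v (torus_of (\<xi> (t + - 2 * k))) (t + - 2 * k)"
          and "V\<^sub>1 = v (torus_of (y0 + h *\<^sub>R q)) (t + h)"
        have "\<bar>V\<^sub>2 - v (torus_of y0) t + l * (- 2 * k)\<bar> \<le> \<epsilon> * (2 * k)"
          using V_near[of "- 2 * k"] k unfolding V\<^sub>2_def by simp
        then have "\<bar>V\<^sub>1 - v (torus_of y0) t - k * l\<bar> \<le> 3 * \<epsilon> * k"
          using upper lower k unfolding V\<^sub>2_def[symmetric] V\<^sub>1_def[symmetric]
          by (simp add: abs_le_iff algebra_simps)
        then show ?thesis unfolding V\<^sub>1_def using k by (simp add: hk)
      qed
    qed
    then show ?thesis using d(1) by blast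
  qed
  show ?thesis
    unfolding has_spacetime_deriv_def \<zeta>t torus_shift_torus_of l_def[symmetric]
  proof (rule LIM_I)
    fix r :: real assume r: "r > 0"
    obtain d where d: "d > 0" "\<And>h. h \<noteq> 0 \<Longrightarrow> \<bar>h\<bar> < d \<Longrightarrow>
      \<bar>v (torus_of (y0 + h *\<^sub>R q)) (t + h) - v (torus_of y0) t + h * l\<bar> \<le> 3 * (r / 6) * \<bar>h\<bar>"
      using main[of "r / 6"] r by auto
    show "\<exists>s>0. \<forall>h. h \<noteq> 0 \<and> norm (h - 0) < s \<longrightarrow>
      norm ((v (torus_of (y0 + h *\<^sub>R q)) (t + h) - v (torus_of y0) t) / h - - l) < r"
    proof (intro exI conjI allI impI)
      fix h :: real assume h: "h \<noteq> 0 \<and> norm (h - 0) < d"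
      define \<Delta> where "\<Delta> = v (torus_of (y0 + h *\<^sub>R q)) (t + h) - v (torus_of y0) t"
      have "\<Delta> / h - - l = (\<Delta> + h * l) / h" using h by (simp add: field_simps)
      then have "\<bar>\<Delta> / h - - l\<bar> = \<bar>\<Delta> + h * l\<bar> / \<bar>h\<bar>" by simp
      also have "\<dots> \<le> r / 2" using d(2)[of h] h by (simp add: \<Delta>_def pos_divide_le_eq)
      finally show "norm ((v (torus_of (y0 + h *\<^sub>R q)) (t + h) - v (torus_of y0) t) / h - - l) < r"
        using r by (simp add: \<Delta>_def)
    qed (rule d)
  qed
qed

text \<open>The segment from (x - kq, t - k) with velocity w ends at time t at x + k (w - q). Its
  start value is read off from q \<in> W, its end value from the spatial gradient; dividing the
  dynamic programming inequality by k gives the claim.\<close>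

lemma lagrangian_subgradient:
  assumes t: "t \<in> {0<..<T}" and q: "q \<in> W_set H g T x t"
    and grad: "has_space_gradient (\<lambda>y. v y t) p x"
  shows "L x t q \<le> L x t w + inner p (w - q)"
proof (rule field_le_epsilon)
  fix e :: real assume e: "e > 0"
  \<comment> \<open>Three errors are made: in the space-time derivative, in the cost of the segment
    and in the gradient expansion.\<close>
  define \<epsilon> where "\<epsilon> = e / 3"
  have \<epsilon>: "\<epsilon> > 0" using e by (simp add: \<epsilon>_def)
  obtain y0 where y0: "x = torus_of y0" using torus_of_surj by metis
  obtain d0 where d0: "d0 > 0"
    "\<And>a b y u. \<bar>a - t\<bar> < d0 \<Longrightarrow> \<bar>b - t\<bar> < d0 \<Longrightarrow> a \<le> b \<Longrightarrow> norm (u - w) < d0 \<Longrightarrow>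
      norm (y - y0) + (b - a) * norm u < d0 \<Longrightarrow>
      v (torus_of y) a \<le> (b - a) * (L x t w + \<epsilon>) + v (torus_of (y + (b - a) *\<^sub>R u)) b"
    using value_line_le[OF t \<epsilon>, of w y0] unfolding y0 by blast
  have "((\<lambda>h. (v (torus_of (y0 + h *\<^sub>R q)) (t + h) - v x t) / h) \<longlongrightarrow> - L x t q) (at 0)"
    using q unfolding W_set_def has_spacetime_deriv_def y0 torus_shift_torus_of by simp
  from LIM_D[OF this \<epsilon>] obtain d1 where d1: "d1 > 0" "\<And>h. h \<noteq> 0 \<Longrightarrow> \<bar>h\<bar> < d1 \<Longrightarrow>
      \<bar>(v (torus_of (y0 + h *\<^sub>R q)) (t + h) - v x t) / h - - L x t q\<bar> < \<epsilon>"
    unfolding real_norm_def diff_zero by blast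
  have "((\<lambda>y. v (torus_of (y0 + y)) t) has_derivative (\<lambda>h. inner h p)) (at 0)"
    using grad unfolding has_space_gradient_def y0 torus_shift_torus_of gderiv_def .
  \<comment> \<open>The tolerance is scaled so that a displacement k (w - q) produces an error of at
    most \<epsilon> k; the summand 1 covers w = q.\<close>
  from this[unfolded has_derivative_at_alt, THEN conjunct2, rule_format, of "\<epsilon> / (norm (w - q) + 1)"]
  obtain d2 where d2: "d2 > 0" "\<And>y. norm y < d2 \<Longrightarrow>
      \<bar>v (torus_of (y0 + y)) t - v x t - inner y p\<bar> \<le> \<epsilon> / (norm (w - q) + 1) * norm y"
    using \<epsilon> unfolding y0 by (auto simp: add_nonneg_pos)
  define M where "M = norm q + norm w + 1"
  have M: "M > 0" by (simp add: M_def add_nonneg_pos)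
  define k where "k = Min {d0 / (2 * M), d0 / 2, d1 / 2, d2 / (2 * M)}"
  have k_pos: "k > 0" unfolding k_def using d0(1) d1(1) d2(1) M by (subst Min_gr_iff) simp_all
  have k_le: "k \<le> d0 / (2 * M)" "k \<le> d0 / 2" "k \<le> d1 / 2" "k \<le> d2 / (2 * M)"
    unfolding k_def by (rule Min_le; simp)+
  note k = k_pos k_le
  have kM: "k * M \<le> d0 / 2" "k * M \<le> d2 / 2"
    using k(2,5) M by (simp_all add: field_simps)
  have kqw: "k * norm q + k * norm w < k * M" using k(1) by (simp add: M_def algebra_simps)
  have "v (torus_of (y0 + (- k) *\<^sub>R q)) (t - k) \<le>
      k * (L x t w + \<epsilon>) + v (torus_of (y0 + (- k) *\<^sub>R q + k *\<^sub>R w)) t"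
    using d0(2)[of "t - k" t w "y0 + (- k) *\<^sub>R q"] k d0(1) kM kqw by simp
  moreover have "y0 + (- k) *\<^sub>R q + k *\<^sub>R w = y0 + k *\<^sub>R (w - q)" by (simp add: algebra_simps)
  moreover have "\<bar>v (torus_of (y0 + k *\<^sub>R (w - q))) t - v x t - k * inner (w - q) p\<bar> \<le> \<epsilon> * k"
  proof -
    have "k * norm (w - q) \<le> k * (norm q + norm w)"
      using k(1) norm_triangle_ineq4[of w q] by (intro mult_left_mono) auto
    moreover have "norm (k *\<^sub>R (w - q)) = k * norm (w - q)" using k(1) by simp
    ultimately have "norm (k *\<^sub>R (w - q)) < d2"
      using kqw kM(2) d2(1) unfolding distrib_left by linarith
    then have "\<bar>v (torus_of (y0 + k *\<^sub>R (w - q))) t - v x t - inner (k *\<^sub>R (w - q)) p\<bar> \<le>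
        \<epsilon> / (norm (w - q) + 1) * norm (k *\<^sub>R (w - q))" by (rule d2(2))
    also have "\<dots> = \<epsilon> * k * (norm (w - q) / (norm (w - q) + 1))" using k(1) by simp
    also have "\<dots> \<le> \<epsilon> * k * 1"
      using \<epsilon> k(1) by (intro mult_left_mono) (auto simp: divide_le_eq add_nonneg_pos)
    finally show ?thesis by simp
  qed
  moreover have "v x t + k * L x t q - \<epsilon> * k \<le> v (torus_of (y0 + (- k) *\<^sub>R q)) (t - k)"
  proof -
    define \<Delta> where "\<Delta> = v (torus_of (y0 + (- k) *\<^sub>R q)) (t - k) - v x t"
    have "\<bar>\<Delta> / (- k) - - L x t q\<bar> < \<epsilon>"
      using d1(2)[of "- k"] k d1(1) by (simp add: \<Delta>_def)
    then have "L x t q - \<epsilon> < \<Delta> / k" by (simp add: abs_less_iff)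
    then have "(L x t q - \<epsilon>) * k < \<Delta>" using k(1) by (simp add: pos_less_divide_eq)
    then show ?thesis by (simp add: \<Delta>_def algebra_simps)
  qed
  ultimately have "k * L x t q \<le> k * (L x t w + inner p (w - q) + 3 * \<epsilon>)"
    by (simp add: abs_le_iff algebra_simps inner_commute)
  then show "L x t q \<le> L x t w + inner p (w - q) + e"
    using k(1) by (simp add: \<epsilon>_def)
qed

text \<open>For w = Hp(-p) convexity gives L(w) \<le> - p \<bullet> w - H(-p). Inserting this w in
  the subgradient inequality yields the same bound with q in place of w, and by the definition of L
  as a supremum q is then a supporting slope of H at -p.\<close>

lemma generalized_velocity_eq:
  assumes t: "t \<in> {0<..<T}" and q: "q \<in> W_set H g T x t"
    and grad: "has_space_gradient (\<lambda>y. v y t) p x"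
    and conv: "convex_on UNIV (H x t)" and deriv: "\<And>p. GDERIV (H x t) p :> Hp p"
  shows "q = Hp (- p)"
proof -
  have t': "t \<in> {0..T}" using t by simp
  define w where "w = Hp (- p)"
  have "L x t w \<le> inner (- p) w - H x t (- p)"
    unfolding lagrangian_def
  proof (rule cSUP_least)
    fix p'
    have "H x t (- p) + inner w (p' - - p) \<le> H x t p'"
      unfolding w_def by (rule convex_gradient_le[OF conv deriv])
    then show "inner p' w - H x t p' \<le> inner (- p) w - H x t (- p)"
      by (simp add: inner_commute inner_add_right)
  qed simp
  then have le: "L x t q \<le> - inner p q - H x t (- p)"
    using lagrangian_subgradient[OF t q grad, of w] by (simp add: inner_diff_right)
  show ?thesis
  proof (rule supporting_slope_eq_gradient[OF deriv])
    fix p'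
    have "inner p' q - H x t p' \<le> - inner p q - H x t (- p)"
      using legendre_le_lagrangian[OF t', of p' q x] le by linarith
    then show "H x t (- p) + inner q (p' - - p) \<le> H x t p'"
      by (simp add: inner_commute inner_add_right)
  qed
qed

lemma optimal_AE_in_A_set:
  assumes opt: "optimal_curve H g T \<zeta>"
  obtains N where "negligible N" "\<And>t. t \<in> {0<..<T} - N \<Longrightarrow> (\<zeta> t, t) \<in> A_set H g T"
proof -
  obtain A where A: "action L 0 T \<zeta> = ereal A" using optimal_action_finite[OF opt] .
  then obtain \<xi> where \<xi>: "abs_cont_on 0 T \<xi>" "\<And>s. s \<in> {0..T} \<Longrightarrow> \<zeta> s = torus_of (\<xi> s)"
    unfolding action_eq_ereal_iff torus_abs_cont_on_def by blast
  have i: "running_cost \<zeta> integrable_on {0..T}"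
    using A unfolding action_eq_ereal_iff running_cost_def[abs_def]
    by (auto intro: set_lebesgue_integral_eq_integral)
  obtain N1 where N1: "negligible N1"
    "\<And>t. t \<in> {0<..<T} - N1 \<Longrightarrow> \<exists>q. (\<xi> has_vector_derivative q) (at t)"
    using abs_cont_on_AE_differentiable[OF \<xi>(1)] by metis
  obtain N2 where N2: "negligible N2" "\<And>t. t \<in> {0<..<T} - N2 \<Longrightarrow>
    ((\<lambda>s. integral {0..s} (running_cost \<zeta>)) has_real_derivative running_cost \<zeta> t) (at t)"
    using AE_has_derivative_indefinite_integral[OF i] by metis
  show ?thesis
  proof
    show "negligible (N1 \<union> N2)" using N1 N2 by (intro negligible_Un)
    fix t assume t: "t \<in> {0<..<T} - (N1 \<union> N2)"
    then have t': "t \<in> {0<..<T}" by simp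
    obtain q where q: "(\<xi> has_vector_derivative q) (at t)" using N1(2)[of t] t by auto
    have "torus_velocity \<zeta> t = q" by (rule torus_velocity_lift[OF \<xi>(2) t' q])
    then have rc: "running_cost \<zeta> t = L (\<zeta> t) t q" by (simp add: running_cost_def)
    \<comment> \<open>The differentiation theorem concerns a variable upper limit, so the tail
      integral is rewritten as the total minus the initial part.\<close>
    have V: "g (\<zeta> T) + (integral {0..T} (running_cost \<zeta>) - integral {0..s} (running_cost \<zeta>)) = v (\<zeta> s) s"
      if "s \<in> {0<..<T}" for s
    proof -
      have "integral {0..s} (running_cost \<zeta>) + integral {s..T} (running_cost \<zeta>) = integral {0..T} (running_cost \<zeta>)"
        using that i by (intro Henstock_Kurzweil_Integration.integral_combine) auto
      then show ?thesis using value_along_optimal[OF opt, of s] that by simp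
    qed
    have "((\<lambda>s. g (\<zeta> T) + (integral {0..T} (running_cost \<zeta>) - integral {0..s} (running_cost \<zeta>)))
        has_real_derivative - L (\<zeta> t) t q) (at t)"
      using N2(2)[of t] t unfolding rc by (auto intro!: derivative_eq_intros)
    then have "((\<lambda>s. v (\<zeta> s) s) has_real_derivative - L (\<zeta> t) t q) (at t)"
      by (rule has_field_derivative_transform_within_open[where S = "{0<..<T}"]) (use V t' in auto)
    from spacetime_deriv_along_curve[OF t' \<xi>(2) q this]
    show "(\<zeta> t, t) \<in> A_set H g T" using t' by (auto simp: A_set_def W_set_def)
  qed
qed

end

theorem proposition7p1:
  fixes H0 :: "('n::finite) torus \<Rightarrow> real \<Rightarrow> real ^ 'n \<Rightarrow> real"
    and H0p :: "'n torus \<Rightarrow> real \<Rightarrow> real ^ 'n \<Rightarrow> real ^ 'n"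
    and g0 :: "'n torus \<Rightarrow> real"
    and T :: real
  assumes T_pos: "0 < T"
    and H0_cont: "continuous_on (UNIV \<times> {0..T} \<times> UNIV) (\<lambda>(x, t, p). H0 x t p)"
    and H0_convex: "\<And>x t. t \<in> {0..T} \<Longrightarrow> convex_on UNIV (H0 x t)"
    and H0_superlinear: "superlinear_on T H0"
    and H0_deriv: "\<And>x t p. t \<in> {0..T} \<Longrightarrow> GDERIV (H0 x t) p :> H0p x t p"
    and g0_cont: "continuous_on UNIV g0"
  shows "\<exists>B \<subseteq> UNIV \<times> {0..T}.
    (\<forall>\<zeta>. optimal_curve H0 g0 T \<zeta> \<longrightarrow>
      (\<exists>S \<in> sets borel. S \<subseteq> B \<and> occupation T \<zeta> S = 1)) \<and>
    B \<subseteq> A_set H0 g0 T \<and>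
    (\<forall>(x, t) \<in> B. \<forall>p. has_space_gradient (\<lambda>y. lax_oleinik H0 g0 T y t) p x \<longrightarrow>
      W_elem H0 g0 T x t = H0p x t (- p))"
proof -
  interpret lax_oleinik_problem H0 T g0
    by unfold_locales fact+
  show ?thesis
  proof (intro exI[of _ "A_set H0 g0 T"] conjI allI impI)
    show "A_set H0 g0 T \<subseteq> UNIV \<times> {0..T}" by (auto simp: A_set_def)
    fix \<zeta> assume opt: "optimal_curve H0 g0 T \<zeta>"
    then have cont: "continuous_on {0..T} \<zeta>" by (simp add: optimal_curve_def)
    obtain N where "negligible N" "\<And>t. t \<in> {0<..<T} - N \<Longrightarrow> (\<zeta> t, t) \<in> A_set H0 g0 T"
      using optimal_AE_in_A_set[OF opt] by metis
    then show "\<exists>S \<in> sets borel. S \<subseteq> A_set H0 g0 T \<and> occupation T \<zeta> S = 1"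
      by (rule graph_full_occupation[OF T_pos cont])
  next
    show "\<forall>(x, t) \<in> A_set H0 g0 T. \<forall>p. has_space_gradient (\<lambda>y. lax_oleinik H0 g0 T y t) p x \<longrightarrow>
      W_elem H0 g0 T x t = H0p x t (- p)"
    proof (clarify)
      fix x t p
      assume xt: "(x, t) \<in> A_set H0 g0 T"
        and grad: "has_space_gradient (\<lambda>y. lax_oleinik H0 g0 T y t) p x"
      then have t: "t \<in> {0<..<T}" and W: "W_set H0 g0 T x t \<noteq> {}" by (auto simp: A_set_def)
      \<comment> \<open>Every element of the set equals the same vector, so the definite description
        in \<open>W_elem\<close> denotes it.\<close>
      have "q = H0p x t (- p)" if "q \<in> W_set H0 g0 T x t" for q
        using t by (intro generalized_velocity_eq[OF t that grad] H0_convex H0_deriv) auto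
      with W show "W_elem H0 g0 T x t = H0p x t (- p)"
        unfolding W_elem_def by (metis ex_in_conv the_equality)
    qed
  qed simp
qed

end
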